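(* Let $r\ge 2$ be an integer and assume $p=1/r$. Then, with probability one, $$\frac{\log_r K_d}{d}\longrightarrow 2,\qquad d\to\infty.$$ Moreover, for every $x\in\mathbb{R}$, $$\mathbb{P}\left(\log_r K_d\le 2d+x\right)\longrightarrow \exp\left(-C\,r^{-x/2}\right),\qquad d\to\infty,\qquad\text{where } C:=\frac{2}{\sqrt{2\pi r(r-1)}}.$$
   Context: Let $\mathbb{T}$ be the infinite $r$-ary tree rooted at $\rho_0$ (every node has exactly $r$ children). To each node $v\in\mathbb{T}$ is attached a random variable $X_v$, where the family $\{X_v:v\in\mathbb{T}\}$ is i.i.d. Bernoulli with $\mathbb{P}(X_v=1)=1-\mathbb{P}(X_v=0)=p\in(0,1)$. A subset $A\subset\mathbb{T}$ is open if $X_v=1$ for all $v\in A$. The generation $\mathrm{gen}(v)$ is the graph distance from $\rho_0$ to $v$ (so $\mathrm{gen}(\rho_0)=0$), and $\mathbb{T}_d=\{v\in\mathbb{T}:\mathrm{gen}(v)\le d\}$. A cluster is a nonempty connected subset of nodes (subtree) $A$ of the undirected tree $\mathbb{T}$; its size $|A|$ is its number of nodes, and its root $\rho(A)$ is the unique node of $A$ of minimal generation. For $d\in\mathbb{N}$, $K_d$ is the size of the largest open cluster whose root has generation at most $d$: $$K_d=\max\{|A|: A \text{ an open cluster with } \rho(A)\in\mathbb{T}_d\},$$ with the convention that the maximum is $0$ if there is no such cluster, that it is read as a supremum in $[0,\infty]$, and that $\log_r 0=-\infty$. $\log_r$ denotes the logarithm in base $r$. *)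

theory Defs
  imports "HOL-Probability.Probability"
begin

text \<open>
  The nodes of the \<open>r\<close>-ary tree are the words over \<open>{0, ..., r - 1}\<close>. The root is the
  empty word and the children of \<open>v\<close> are the words \<open>i # v\<close> with \<open>i < r\<close>, so that a word lists
  the path from the node up to the root.
\<close>

type_synonym node = "nat list"

definition nodes :: "nat \<Rightarrow> node set" where
  "nodes r = lists {..<r}"

definition edges :: "nat \<Rightarrow> node rel" where
  "edges r = {(u, v). u \<in> nodes r \<and> v \<in> nodes r \<and> ((\<exists>i. v = i # u) \<or> (\<exists>i. u = i # v))}"

definition gen :: "nat \<Rightarrow> node \<Rightarrow> nat" where
  "gen r v = (LEAST n. ([], v) \<in> edges r ^^ n)"

definition nodes_upto :: "nat \<Rightarrow> nat \<Rightarrow> node set" where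
  "nodes_upto r d = {v \<in> nodes r. gen r v \<le> d}"

definition cluster :: "nat \<Rightarrow> node set \<Rightarrow> bool" where
  "cluster r A \<longleftrightarrow> A \<noteq> {} \<and> A \<subseteq> nodes r \<and> (\<forall>u\<in>A. \<forall>v\<in>A. (u, v) \<in> (edges r \<inter> A \<times> A)\<^sup>*)"

definition cluster_root :: "nat \<Rightarrow> node set \<Rightarrow> node" where
  "cluster_root r A = (THE v. v \<in> A \<and> (\<forall>w\<in>A. gen r v \<le> gen r w))"

definition open_nodes :: "(node \<Rightarrow> real) \<Rightarrow> node set \<Rightarrow> bool" where
  "open_nodes x A \<longleftrightarrow> (\<forall>v\<in>A. x v = 1)"

text \<open>Clusters may be infinite, whereas \<^const>\<open>card\<close> is \<open>0\<close> on infinite sets.\<close>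

definition cluster_size :: "node set \<Rightarrow> enat" where
  "cluster_size A = (if finite A then enat (card A) else \<infinity>)"

text \<open>\<open>K r x d\<close> is \<open>K\<^sub>d\<close> in the configuration \<open>x\<close>. The supremum of the empty set
  in \<^typ>\<open>enat\<close> is \<open>0\<close>.\<close>

definition K :: "nat \<Rightarrow> (node \<Rightarrow> real) \<Rightarrow> nat \<Rightarrow> enat" where
  "K r x d = Sup {cluster_size A | A.
     cluster r A \<and> open_nodes x A \<and> cluster_root r A \<in> nodes_upto r d}"

definition log_enat :: "real \<Rightarrow> enat \<Rightarrow> ereal" where
  "log_enat b n = (case n of
       enat k \<Rightarrow> if k = 0 then -\<infinity> else ereal (log b (real k))
     | \<infinity> \<Rightarrow> \<infinity>)"

lemma gen_eq_length:
  assumes "v \<in> nodes r"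
  shows "gen r v = length v"
  unfolding gen_def
proof (rule Least_equality)
  show "([], v) \<in> edges r ^^ length v"
    using assms
  proof (induction v)
    case Nil
    then show ?case by simp
  next
    case (Cons i v)
    then have "([], v) \<in> edges r ^^ length v" "(v, i # v) \<in> edges r"
      by (auto simp: nodes_def edges_def)
    then show ?case by auto
  qed
next
  fix n
  assume "([], v) \<in> edges r ^^ n"
  then show "length v \<le> n"
  proof (induction n arbitrary: v)
    case 0
    then show ?case by simp
  next
    case (Suc n)
    then obtain u where u: "([], u) \<in> edges r ^^ n" "(u, v) \<in> edges r"
      by auto
    have "length v \<le> Suc (length u)"
      using u(2) by (auto simp: edges_def)
    then show ?case using Suc.IH[OF u(1)] by simp
  qed
qed

lemma cluster_root_unique:
  assumes "cluster r A"
  shows "\<exists>!v. v \<in> A \<and> (\<forall>w\<in>A. gen r v \<le> gen r w)"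
proof -
  have sub: "A \<subseteq> nodes r" and "A \<noteq> {}"
    and conn: "\<And>u v. u \<in> A \<Longrightarrow> v \<in> A \<Longrightarrow> (u, v) \<in> (edges r \<inter> A \<times> A)\<^sup>*"
    using assms by (auto simp: cluster_def)
  obtain u where u: "u \<in> A" "\<forall>w\<in>A. gen r u \<le> gen r w"
    using \<open>A \<noteq> {}\<close> ex_has_least_nat[of "\<lambda>v. v \<in> A" _ "gen r"] by blast
  have le: "length u \<le> length w" if "w \<in> A" for w
    using u that sub gen_eq_length by (metis subsetD)
  show ?thesis
  proof (rule ex1I)
    show "u \<in> A \<and> (\<forall>w\<in>A. gen r u \<le> gen r w)"
      using u by blast
  next
    fix v
    assume v: "v \<in> A \<and> (\<forall>w\<in>A. gen r v \<le> gen r w)"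
    have suffix: "drop (length w - length u) w = u" if "(u, w) \<in> (edges r \<inter> A \<times> A)\<^sup>*" for w
      using that
    proof (induction rule: rtrancl_induct)
      case base
      then show ?case by simp
    next
      case (step w w')
      have "w \<in> A" "w' \<in> A" using step.hyps by auto
      then have "length u \<le> length w" "length u \<le> length w'" using le by auto
      moreover have "(\<exists>i. w' = i # w) \<or> (\<exists>i. w = i # w')"
        using step.hyps by (auto simp: edges_def)
      ultimately show ?case
        using step.IH by (auto simp: Suc_diff_le)
    qed
    have "length v = length u"
      using u v sub gen_eq_length by (metis subsetD le_antisym)
    then show "v = u"
      using suffix[OF conn] u(1) v by fastforce
  qed
qed

end

theory Submission
  imports Defs "HOL-Real_Asymp.Real_Asymp"
begin

text \<open>
  Let \<open>q n\<close> be the probability that the open cluster formed by a node and its descendants has more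
  than \<open>n\<close> nodes. Its generating function satisfies a fixed point equation of degree \<open>r\<close>, which by
  criticality makes \<open>\<Sum>n. q n * s ^ n\<close> asymptotic to a constant times \<open>(1 - s) powr (- 1 / 2)\<close>
  as \<open>s\<close> tends to \<open>1\<close>. Since \<open>q\<close> is monotone, Karamata's Tauberian theorem gives
  \<open>q n \<sim> C / sqrt n\<close>.

  Clusters rooted at the \<open>r ^ d\<close> nodes of generation \<open>d\<close> are independent, so that
  \<open>P(K\<^sub>d \<le> n) \<le> (1 - q n) ^ r ^ d\<close>. The two sides differ by at most the probability that some node
  above generation \<open>d\<close> has a cluster of more than \<open>n\<close> nodes while none of its children has one. By
  criticality this probability is \<open>O((q n)\<^sup>2)\<close> for each node, which is negligible when \<open>r ^ d * q n\<close>
  stays bounded. The choice \<open>n = r powr (2 * d + x)\<close> gives the limit law, and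
  \<open>n = r powr ((2 \<plusminus> e) * d)\<close> together with the Borel-Cantelli lemma the almost sure limit.
\<close>

section \<open>Karamata's theorem\<close>

text \<open>At \<open>p = 1 / r\<close> an open node has on average one open child. The linear terms
  of the fixed point equation then cancel and the quadratic one, with coefficient
  \<open>r * (r - 1) / 2\<close>, decides: the generating function of the cluster size differs from
  \<open>1\<close> by about \<open>sqrt (2 * (1 - s) / (r * (r - 1)))\<close>. The Tauberian theorem
  divides by \<open>Gamma (1 / 2) = sqrt pi\<close>, and together these factors are
  \<open>C\<close>. Two obstacles shape the rest. Clusters may be infinite a priori, so expectations
  are taken for clusters truncated at a finite height; height \<open>n + 1\<close> already decides
  whether there are more than \<open>n\<close> nodes. And a union bound over the levels above
  \<open>d\<close> is too weak for the limit law, because the expected number of large clusters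
  rooted there has the same order as at level \<open>d\<close>. Most of them, however, have a large
  cluster rooted at a child, and only the others can cause a discrepancy.\<close>

definition gamma_distr :: "real \<Rightarrow> real measure" where
  "gamma_distr \<rho> =
    density lborel (\<lambda>t. ennreal (indicator {0..} t * t powr (\<rho> - 1) / exp t / Gamma \<rho>))"

text \<open>The limit functional in Karamata's theorem. With \<open>s = exp (- h)\<close> and
  \<open>t = n * h\<close>, a sequence growing like \<open>n powr (\<rho> - 1)\<close> has weights
  \<open>a n * s ^ n\<close> of the shape \<open>t powr (\<rho> - 1) * exp (- t)\<close>. Tests are
  functions of \<open>x = exp (- t) = s ^ n\<close>, which ranges over a compact interval, so that
  polynomials in \<open>x\<close> approximate them uniformly.\<close>

definition gamma_mean :: "real \<Rightarrow> (real \<Rightarrow> real) \<Rightarrow> real" where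
  "gamma_mean \<rho> f = (\<integral>t. f (exp (- t)) \<partial>gamma_distr \<rho>)"

lemma sets_gamma_distr [measurable_cong, simp]: "sets (gamma_distr \<rho>) = sets borel"
  by (simp add: gamma_distr_def)

lemma nn_integral_powr_exp:
  assumes "\<rho> > (0::real)" "c > 0"
  shows "(\<integral>\<^sup>+t. ennreal (indicator {0..} t * t powr (\<rho> - 1) / exp (c * t)) \<partial>lborel) =
    ennreal (Gamma \<rho> / c powr \<rho>)"
proof -
  have "ennreal (Gamma \<rho>) =
      ennreal \<bar>c\<bar> * (\<integral>\<^sup>+t. ennreal (indicator {0..} (0 + c * t) * (0 + c * t) powr (\<rho> - 1) / exp (0 + c * t)) \<partial>lborel)"
    unfolding Gamma_conv_nn_integral_real[OF assms(1)]
    using assms by (intro nn_integral_real_affine) auto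
  also have "\<dots> = ennreal \<bar>c\<bar> * (\<integral>\<^sup>+t. ennreal (c powr (\<rho> - 1)) *
      ennreal (indicator {0..} t * t powr (\<rho> - 1) / exp (c * t)) \<partial>lborel)"
    using assms
    by (intro arg_cong2[where f = "(*)"] nn_integral_cong refl)
      (auto simp: indicator_def powr_mult zero_le_mult_iff simp flip: ennreal_mult)
  also have "\<dots> = ennreal (c powr \<rho>) *
      (\<integral>\<^sup>+t. ennreal (indicator {0..} t * t powr (\<rho> - 1) / exp (c * t)) \<partial>lborel)"
    using assms
    by (subst nn_integral_cmult) (auto simp: mult.assoc[symmetric] powr_diff simp flip: ennreal_mult)
  finally have *: "ennreal (Gamma \<rho>) = ennreal (c powr \<rho>) *
      (\<integral>\<^sup>+t. ennreal (indicator {0..} t * t powr (\<rho> - 1) / exp (c * t)) \<partial>lborel)" (is "_ = _ * ?I") .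
  have "ennreal (Gamma \<rho> / c powr \<rho>) = ennreal (1 / c powr \<rho>) * ennreal (Gamma \<rho>)"
    using assms by (simp flip: ennreal_mult)
  also have "\<dots> = ennreal (1 / c powr \<rho>) * ennreal (c powr \<rho>) * ?I"
    unfolding * by (simp add: mult.assoc)
  also have "ennreal (1 / c powr \<rho>) * ennreal (c powr \<rho>) = 1"
    using assms by (simp flip: ennreal_mult)
  finally show ?thesis by simp
qed

lemma nn_integral_gamma_distr_power:
  assumes "\<rho> > 0"
  shows "(\<integral>\<^sup>+t. ennreal (exp (- t) ^ k) \<partial>gamma_distr \<rho>) = ennreal (1 / real (Suc k) powr \<rho>)"
proof -
  have G: "Gamma \<rho> > 0" using assms by simp
  have "(\<integral>\<^sup>+t. ennreal (exp (- t) ^ k) \<partial>gamma_distr \<rho>) =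
      (\<integral>\<^sup>+t. ennreal (indicator {0..} t * t powr (\<rho> - 1) / exp t / Gamma \<rho>) *
        ennreal (exp (- t) ^ k) \<partial>lborel)"
    unfolding gamma_distr_def by (subst nn_integral_density) auto
  also have "\<dots> = (\<integral>\<^sup>+t. ennreal (1 / Gamma \<rho>) *
      ennreal (indicator {0..} t * t powr (\<rho> - 1) / exp (real (Suc k) * t)) \<partial>lborel)"
  proof (intro nn_integral_cong)
    fix t :: real
    have "exp (- t) ^ k / exp t = 1 / exp (real (Suc k) * t)"
      by (simp add: exp_minus distrib_right exp_add exp_of_nat_mult[symmetric] field_simps)
    then have "indicator {0..} t * t powr (\<rho> - 1) / exp t / Gamma \<rho> * exp (- t) ^ k =
        1 / Gamma \<rho> * (indicator {0..} t * t powr (\<rho> - 1) / exp (real (Suc k) * t))"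
      using G by (simp add: field_simps)
    then show "ennreal (indicator {0..} t * t powr (\<rho> - 1) / exp t / Gamma \<rho>) * ennreal (exp (- t) ^ k) =
        ennreal (1 / Gamma \<rho>) * ennreal (indicator {0..} t * t powr (\<rho> - 1) / exp (real (Suc k) * t))"
      using G by (simp flip: ennreal_mult)
  qed
  also have "\<dots> = ennreal (1 / Gamma \<rho>) * ennreal (Gamma \<rho> / real (Suc k) powr \<rho>)"
    using nn_integral_powr_exp[OF assms, of "real (Suc k)"] by (subst nn_integral_cmult) auto
  also have "\<dots> = ennreal (1 / real (Suc k) powr \<rho>)"
    using G by (simp flip: ennreal_mult)
  finally show ?thesis .
qed

lemma prob_space_gamma_distr:
  assumes "\<rho> > 0"
  shows "prob_space (gamma_distr \<rho>)"
proof
  show "emeasure (gamma_distr \<rho>) (space (gamma_distr \<rho>)) = 1"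
    using nn_integral_gamma_distr_power[OF assms, of 0] by simp
qed

lemma AE_gamma_distr: "AE t in gamma_distr \<rho>. 0 \<le> t"
  unfolding gamma_distr_def by (subst AE_density) (auto intro!: AE_I2 simp: indicator_def)

lemma gamma_mean_power:
  assumes "\<rho> > 0"
  shows "gamma_mean \<rho> (\<lambda>x. x ^ k) = 1 / real (Suc k) powr \<rho>"
  unfolding gamma_mean_def using nn_integral_gamma_distr_power[OF assms, of k]
  by (subst integral_eq_nn_integral) auto

lemma continuous_bounded_unit_interval:
  assumes "continuous_on UNIV (f :: real \<Rightarrow> real)"
  obtains B where "B \<ge> 0" "\<And>x. 0 \<le> x \<Longrightarrow> x \<le> 1 \<Longrightarrow> \<bar>f x\<bar> \<le> B"
proof -
  have "bounded (f ` {0..1})"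
    using assms by (intro compact_imp_bounded compact_continuous_image)
      (auto intro: continuous_on_subset)
  then obtain B where "\<forall>x\<in>{0..1}. \<bar>f x\<bar> \<le> B"
    unfolding bounded_iff by auto
  then show thesis by (intro that[of "max B 0"]) (auto simp: max.coboundedI1)
qed

lemma integrable_gamma_distr:
  assumes "\<rho> > 0" "continuous_on UNIV f"
  shows "integrable (gamma_distr \<rho>) (\<lambda>t. f (exp (- t)) :: real)"
proof -
  interpret prob_space "gamma_distr \<rho>" using assms(1) by (rule prob_space_gamma_distr)
  obtain B where B: "\<And>x. 0 \<le> x \<Longrightarrow> x \<le> 1 \<Longrightarrow> \<bar>f x\<bar> \<le> B"
    using continuous_bounded_unit_interval[OF assms(2)] by blast
  have "(\<lambda>t. f (exp (- t))) \<in> borel_measurable borel"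
    using assms(2) by (intro borel_measurable_continuous_onI continuous_on_compose2[OF assms(2)])
      (auto intro!: continuous_intros)
  then show ?thesis
  proof (intro integrable_const_bound[where B = B])
    show "AE t in gamma_distr \<rho>. norm (f (exp (- t))) \<le> B"
      using AE_gamma_distr[of \<rho>] by eventually_elim (auto intro: B)
  qed simp
qed

lemma gamma_mean_diff_le:
  assumes "\<rho> > 0" "continuous_on UNIV f" "continuous_on UNIV g"
    and "\<And>x. 0 \<le> x \<Longrightarrow> x \<le> 1 \<Longrightarrow> \<bar>f x - g x\<bar> \<le> e"
  shows "\<bar>gamma_mean \<rho> f - gamma_mean \<rho> g\<bar> \<le> e"
proof -
  interpret prob_space "gamma_distr \<rho>" using assms(1) by (rule prob_space_gamma_distr)
  have int: "integrable (gamma_distr \<rho>) (\<lambda>t. f (exp (- t)))" "integrable (gamma_distr \<rho>) (\<lambda>t. g (exp (- t)))"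
    using assms by (auto intro: integrable_gamma_distr)
  have "\<bar>gamma_mean \<rho> f - gamma_mean \<rho> g\<bar> = \<bar>\<integral>t. f (exp (- t)) - g (exp (- t)) \<partial>gamma_distr \<rho>\<bar>"
    using int by (simp add: gamma_mean_def)
  also have "\<dots> \<le> (\<integral>t. \<bar>f (exp (- t)) - g (exp (- t))\<bar> \<partial>gamma_distr \<rho>)"
    by (rule integral_abs_bound)
  also have "\<dots> \<le> (\<integral>t. e \<partial>gamma_distr \<rho>)"
  proof (intro integral_mono_AE)
    show "AE t in gamma_distr \<rho>. \<bar>f (exp (- t)) - g (exp (- t))\<bar> \<le> e"
      using AE_gamma_distr[of \<rho>] by eventually_elim (auto intro: assms(4))
  qed (use int in auto)
  finally show ?thesis by (simp add: prob_space)
qed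

section \<open>Karamata's theorem for continuous test functions\<close>

lemma at_left_1_eventually: "eventually (\<lambda>s::real. 0 < s \<and> s < 1) (at_left 1)"
  using eventually_at_left_real[of 0 1] by simp

lemma summable_power_test_function:
  assumes "continuous_on UNIV (f :: real \<Rightarrow> real)" "0 < s" "s < 1"
    and "\<And>n. 0 \<le> a n" "summable (\<lambda>n. a n * s ^ n)"
  shows "summable (\<lambda>n. a n * s ^ n * f (s ^ n))"
proof -
  obtain B where B: "\<And>x. 0 \<le> x \<Longrightarrow> x \<le> 1 \<Longrightarrow> \<bar>f x\<bar> \<le> B"
    using continuous_bounded_unit_interval[OF assms(1)] by blast
  have "norm (a n * s ^ n * f (s ^ n)) \<le> a n * s ^ n * B" for n
  proof -
    have "\<bar>f (s ^ n)\<bar> \<le> B"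
      using assms by (intro B) (simp_all add: power_le_one)
    then have "a n * s ^ n * \<bar>f (s ^ n)\<bar> \<le> a n * s ^ n * B"
      using assms by (intro mult_left_mono) simp_all
    then show ?thesis
      using assms(2) assms(4)[of n] by (simp add: abs_mult)
  qed
  then show ?thesis
    by (rule summable_comparison_test'[OF summable_mult2[OF assms(5)]])
qed

text \<open>For the monomial \<open>x ^ k\<close> the sum is the original power series at the point
  \<open>s ^ Suc k\<close>, so the hypothesis itself yields the limit. Linearity gives polynomials.
  The weights are nonnegative and their total mass converges, so a uniform error in the test
  function causes a proportional error in the sum, and Weierstrass approximation finishes.\<close>

theorem karamata_continuous:
  fixes a :: "nat \<Rightarrow> real" and f :: "real \<Rightarrow> real"
  assumes \<rho>: "\<rho> > 0" and nonneg: "\<And>n. 0 \<le> a n"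
    and summ: "\<And>s. 0 < s \<Longrightarrow> s < 1 \<Longrightarrow> summable (\<lambda>n. a n * s ^ n)"
    and lim: "((\<lambda>s. (1 - s) powr \<rho> * (\<Sum>n. a n * s ^ n)) \<longlongrightarrow> c) (at_left 1)"
    and f: "continuous_on UNIV f"
  shows "((\<lambda>s. (1 - s) powr \<rho> * (\<Sum>n. a n * s ^ n * f (s ^ n))) \<longlongrightarrow> c * gamma_mean \<rho> f) (at_left 1)"
proof -
  define A where "A f s = (1 - s) powr \<rho> * (\<Sum>n. a n * s ^ n * f (s ^ n))" for f s
  have summf: "summable (\<lambda>n. a n * s ^ n * g (s ^ n))"
    if "continuous_on UNIV g" "0 < s" "s < 1" for s and g :: "real \<Rightarrow> real"
    using summable_power_test_function that nonneg summ by blast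
  have c: "c \<ge> 0"
  proof (rule tendsto_lowerbound[OF lim])
    show "\<forall>\<^sub>F s in at_left 1. 0 \<le> (1 - s) powr \<rho> * (\<Sum>n. a n * s ^ n)"
      using at_left_1_eventually
      by eventually_elim (auto intro!: mult_nonneg_nonneg suminf_nonneg summ nonneg)
  qed simp
  have mono: "(A (\<lambda>x. x ^ k) \<longlongrightarrow> c * gamma_mean \<rho> (\<lambda>x. x ^ k)) (at_left 1)" for k
  proof -
    have "((\<lambda>s::real. s ^ Suc k) \<longlongrightarrow> 1 ^ Suc k) (at_left 1)"
      by (intro tendsto_intros)
    moreover have "eventually (\<lambda>s::real. s ^ Suc k < 1) (at_left 1)"
      using at_left_1_eventually by eventually_elim (auto simp: power_Suc_less_one simp del: power_Suc)
    ultimately have "filterlim (\<lambda>s::real. s ^ Suc k) (at_left 1) (at_left 1)"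
      by (intro tendsto_imp_filterlim_at_left) (simp_all only: power_one)
    then have 1: "((\<lambda>s. (1 - s ^ Suc k) powr \<rho> * (\<Sum>n. a n * (s ^ Suc k) ^ n)) \<longlongrightarrow> c) (at_left 1)"
      by (rule filterlim_compose[OF lim])
    \<comment> \<open>The quotient of \<open>1 - s\<close> by \<open>1 - s ^ Suc k\<close> is the
      reciprocal of a geometric sum and tends to \<open>1 / Suc k\<close>; its power
      \<open>\<rho>\<close> is the moment \<open>gamma_mean_power\<close>.\<close>
    have "((\<lambda>s::real. (1 / (\<Sum>i<Suc k. s ^ i)) powr \<rho>) \<longlongrightarrow> (1 / (\<Sum>i<Suc k. 1 ^ i)) powr \<rho>) (at_left 1)"
      by (intro tendsto_intros) auto
    from tendsto_mult[OF this 1]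
    have 2: "((\<lambda>s. (1 / (\<Sum>i<Suc k. s ^ i)) powr \<rho> * ((1 - s ^ Suc k) powr \<rho> * (\<Sum>n. a n * (s ^ Suc k) ^ n)))
        \<longlongrightarrow> c * gamma_mean \<rho> (\<lambda>x. x ^ k)) (at_left 1)"
      using \<rho> by (simp add: gamma_mean_power powr_divide)
    show ?thesis
    proof (rule Lim_transform_eventually[OF 2])
      show "\<forall>\<^sub>F s in at_left 1. (1 / (\<Sum>i<Suc k. s ^ i)) powr \<rho> *
          ((1 - s ^ Suc k) powr \<rho> * (\<Sum>n. a n * (s ^ Suc k) ^ n)) = A (\<lambda>x. x ^ k) s"
        using at_left_1_eventually
      proof eventually_elim
        case (elim s)
        have pos: "(\<Sum>i<Suc k. s ^ i) > 0"
          using elim by (intro sum_pos) auto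
        have "(1 / (\<Sum>i<Suc k. s ^ i)) powr \<rho> * (1 - s ^ Suc k) powr \<rho> =
            (1 / (\<Sum>i<Suc k. s ^ i) * (1 - s ^ Suc k)) powr \<rho>"
          by (rule powr_mult[symmetric])
        also have "1 / (\<Sum>i<Suc k. s ^ i) * (1 - s ^ Suc k) = 1 - s"
          unfolding one_diff_power_eq using pos by (simp del: sum.lessThan_Suc)
        finally have *: "(1 / (\<Sum>i<Suc k. s ^ i)) powr \<rho> * (1 - s ^ Suc k) powr \<rho> = (1 - s) powr \<rho>" .
        have "(\<lambda>n. a n * (s ^ Suc k) ^ n) = (\<lambda>n. a n * s ^ n * (s ^ n) ^ k)"
          by (simp add: fun_eq_iff power_mult_distrib mult.assoc flip: power_mult) (simp add: mult.commute)
        then show ?case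
          unfolding A_def * [symmetric] by (simp only: mult.assoc)
      qed
    qed
  qed
  have poly: "(A g \<longlongrightarrow> c * gamma_mean \<rho> g) (at_left 1)" if pg: "real_polynomial_function g" for g
  proof -
    obtain b m where g: "g = (\<lambda>x. \<Sum>i\<le>m. b i * x ^ i)"
      using pg unfolding real_polynomial_function_iff_sum by (elim exE)
    have int: "integrable (gamma_distr \<rho>) (\<lambda>t. exp (- t) ^ i :: real)" for i
      by (rule integrable_gamma_distr[OF \<rho>, of "\<lambda>x. x ^ i"]) (intro continuous_intros)
    have "((\<lambda>s. \<Sum>i\<le>m. b i * A (\<lambda>x. x ^ i) s) \<longlongrightarrow> (\<Sum>i\<le>m. b i * (c * gamma_mean \<rho> (\<lambda>x. x ^ i)))) (at_left 1)"
      by (intro tendsto_intros mono)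
    also have "(\<Sum>i\<le>m. b i * (c * gamma_mean \<rho> (\<lambda>x. x ^ i))) = c * gamma_mean \<rho> g"
      using int by (simp add: gamma_mean_def g sum_distrib_left mult.left_commute)
    finally show ?thesis
    proof (rule Lim_transform_eventually)
      show "\<forall>\<^sub>F s in at_left 1. (\<Sum>i\<le>m. b i * A (\<lambda>x. x ^ i) s) = A g s"
        using at_left_1_eventually
      proof eventually_elim
        case (elim s)
        have sm: "summable (\<lambda>n. a n * s ^ n * (s ^ n) ^ i)" for i
          by (rule summf[of "\<lambda>x. x ^ i"]) (use elim in \<open>auto intro: continuous_intros\<close>)
        have "(\<Sum>n. a n * s ^ n * g (s ^ n)) = (\<Sum>n. \<Sum>i\<le>m. b i * (a n * s ^ n * (s ^ n) ^ i))"
          by (simp add: g sum_distrib_left mult_ac)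
        also have "\<dots> = (\<Sum>i\<le>m. \<Sum>n. b i * (a n * s ^ n * (s ^ n) ^ i))"
          using sm by (intro suminf_sum summable_mult)
        also have "\<dots> = (\<Sum>i\<le>m. b i * (\<Sum>n. a n * s ^ n * (s ^ n) ^ i))"
          using sm by (intro sum.cong refl suminf_mult)
        finally show ?case
          by (simp add: A_def sum_distrib_left mult.left_commute)
      qed
    qed
  qed
  have "(A f \<longlongrightarrow> c * gamma_mean \<rho> f) (at_left 1)"
  proof (rule tendstoI)
    fix e :: real assume e: "e > 0"
    \<comment> \<open>A third of \<open>e\<close> each for replacing \<open>f\<close> by
      \<open>g\<close> in the sum, for the convergence with \<open>g\<close>, and for replacing
      \<open>g\<close> by \<open>f\<close> in the limit. The mass is eventually below
      \<open>c + 1\<close>, which is positive even if \<open>c = 0\<close>.\<close>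
    define \<eta> where "\<eta> = e / (3 * (c + 1))"
    have \<eta>: "\<eta> > 0" using c e by (simp add: \<eta>_def)
    obtain g where g: "real_polynomial_function g" "\<And>x. x \<in> {0..1} \<Longrightarrow> \<bar>f x - g x\<bar> < \<eta>"
      by (rule Stone_Weierstrass_real_polynomial_function
          [of "{0..1}", OF compact_Icc continuous_on_subset[OF f subset_UNIV] \<eta>])
        (rule that; blast)
    have cg: "continuous_on UNIV g"
      using g(1) by (simp add: continuous_on_polymonial_function real_polynomial_function_eq)
    have "\<forall>\<^sub>F s in at_left 1. \<bar>A g s - c * gamma_mean \<rho> g\<bar> < e / 3"
      using tendstoD[OF poly[OF g(1)], of "e / 3"] e by (simp add: dist_real_def)
    moreover have "\<forall>\<^sub>F s in at_left 1. (1 - s) powr \<rho> * (\<Sum>n. a n * s ^ n) < c + 1"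
      using order_tendstoD(2)[OF lim, of "c + 1"] by simp
    ultimately show "\<forall>\<^sub>F s in at_left 1. dist (A f s) (c * gamma_mean \<rho> f) < e"
      using at_left_1_eventually
    proof eventually_elim
      case (elim s)
      note s = \<open>0 < s \<and> s < 1\<close>
      have sd: "summable (\<lambda>n. a n * s ^ n * f (s ^ n))" "summable (\<lambda>n. a n * s ^ n * g (s ^ n))"
        using summf f cg s by auto
      have "norm (a n * s ^ n * f (s ^ n) - a n * s ^ n * g (s ^ n)) \<le> a n * s ^ n * \<eta>" for n
      proof -
        have "\<bar>f (s ^ n) - g (s ^ n)\<bar> \<le> \<eta>"
          using g(2)[of "s ^ n"] s by (auto simp: power_le_one)
        then have "a n * s ^ n * \<bar>f (s ^ n) - g (s ^ n)\<bar> \<le> a n * s ^ n * \<eta>"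
          using nonneg s by (intro mult_left_mono) auto
        then show ?thesis
          using nonneg[of n] s by (simp add: abs_mult flip: right_diff_distrib)
      qed
      then have "norm (\<Sum>n. a n * s ^ n * f (s ^ n) - a n * s ^ n * g (s ^ n)) \<le> (\<Sum>n. a n * s ^ n * \<eta>)"
        using summ s by (intro norm_suminf_le summable_mult2) auto
      then have "\<bar>(\<Sum>n. a n * s ^ n * f (s ^ n)) - (\<Sum>n. a n * s ^ n * g (s ^ n))\<bar> \<le> (\<Sum>n. a n * s ^ n) * \<eta>"
        using sd summ s by (simp add: suminf_diff suminf_mult2)
      then have "(1 - s) powr \<rho> * \<bar>(\<Sum>n. a n * s ^ n * f (s ^ n)) - (\<Sum>n. a n * s ^ n * g (s ^ n))\<bar> \<le>
          (1 - s) powr \<rho> * ((\<Sum>n. a n * s ^ n) * \<eta>)"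
        by (intro mult_left_mono) auto
      then have "\<bar>A f s - A g s\<bar> \<le> (1 - s) powr \<rho> * (\<Sum>n. a n * s ^ n) * \<eta>"
        by (simp add: A_def mult.assoc abs_mult flip: right_diff_distrib)
      also have "\<dots> \<le> (c + 1) * \<eta>"
        using elim \<eta> by (intro mult_right_mono) auto
      finally have 1: "\<bar>A f s - A g s\<bar> \<le> (c + 1) * \<eta>" .
      have "\<bar>gamma_mean \<rho> f - gamma_mean \<rho> g\<bar> \<le> \<eta>"
        using g(2) by (intro gamma_mean_diff_le \<rho> f cg) force
      then have "c * \<bar>gamma_mean \<rho> f - gamma_mean \<rho> g\<bar> \<le> (c + 1) * \<eta>"
        using c \<eta> by (intro mult_mono) auto
      then have 2: "\<bar>c * gamma_mean \<rho> f - c * gamma_mean \<rho> g\<bar> \<le> (c + 1) * \<eta>"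
        using c by (simp add: abs_mult flip: right_diff_distrib)
      have "(c + 1) * \<eta> = e / 3"
        using c by (simp add: \<eta>_def field_simps)
      with 1 2 elim(1) show ?case unfolding dist_real_def by linarith
    qed
  qed
  then show ?thesis by (simp add: A_def[abs_def])
qed

section \<open>Tent functions and the Tauberian step for monotone sequences\<close>

text \<open>A continuous substitute for the indicator of \<open>u < t < v\<close> in the variable
  \<open>x = exp (- t)\<close>. It localises the index \<open>n\<close> to a window while remaining
  an admissible test function.\<close>

definition tent :: "real \<Rightarrow> real \<Rightarrow> real \<Rightarrow> real" where
  "tent u v x = max 0 (min (x - exp (- v)) (exp (- u) - x))"

lemma tent_nonneg: "tent u v x \<ge> 0"
  by (simp add: tent_def)

lemma tent_pos_iff: "tent u v (exp (- t)) > 0 \<longleftrightarrow> u < t \<and> t < v"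
  by (auto simp: tent_def less_max_iff_disj)

lemma continuous_tent: "continuous_on A (tent u v)"
  unfolding tent_def[abs_def] by (intro continuous_intros)

lemma gamma_mean_tent:
  assumes "\<rho> > 0"
  shows "gamma_mean \<rho> (tent u v) =
    (\<integral>t. indicator {0..} t * t powr (\<rho> - 1) / exp t / Gamma \<rho> * tent u v (exp (- t)) \<partial>lborel)"
    (is "_ = integral\<^sup>L lborel ?f")
    and "integrable lborel
      (\<lambda>t. indicator {0..} t * t powr (\<rho> - 1) / exp t / Gamma \<rho> * tent u v (exp (- t)))"
proof -
  have [measurable]: "tent u v \<in> borel_measurable borel"
    by (rule borel_measurable_continuous_onI[OF continuous_tent])
  have G: "Gamma \<rho> > 0" using assms by simp
  show "gamma_mean \<rho> (tent u v) = integral\<^sup>L lborel ?f"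
    unfolding gamma_mean_def gamma_distr_def
    by (subst integral_real_density) (use G in \<open>auto intro!: AE_I2\<close>)
  show "integrable lborel ?f"
    using integrable_gamma_distr[OF assms continuous_tent[of UNIV u v]]
    unfolding gamma_distr_def
    by (subst (asm) integrable_real_density) (use G in \<open>auto intro!: AE_I2\<close>)
qed

text \<open>The means with \<open>\<rho> = 1\<close> serve as denominators when averages over a
  window are normalised.\<close>

lemma gamma_mean_tent_pos:
  assumes "0 < u" "u < v"
  shows "gamma_mean 1 (tent u v) > 0"
proof -
  let ?f = "\<lambda>t. indicator {0..} t * t powr (1 - 1) / exp t / Gamma 1 * tent u v (exp (- t))"
  note f = gamma_mean_tent[of 1 u v, OF zero_less_one]
  have nonneg: "?f t \<ge> 0" for t by (simp add: tent_nonneg)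
  have "gamma_mean 1 (tent u v) \<noteq> 0"
  proof
    assume "gamma_mean 1 (tent u v) = 0"
    then have "AE t in lborel. ?f t = 0"
      using integral_nonneg_eq_0_iff_AE[OF f(2) AE_I2[OF nonneg]] unfolding f(1) by (rule iffD1[rotated])
    then have "AE t in lborel. t \<notin> {u<..<v}"
    proof eventually_elim
      case (elim t)
      show ?case
      proof
        assume t: "t \<in> {u<..<v}"
        then have "tent u v (exp (- t)) > 0" by (simp add: tent_pos_iff)
        with elim t assms show False by simp
      qed
    qed
    then have "{u<..<v} \<in> null_sets lborel"
      by (subst (asm) AE_iff_null_sets[symmetric]) auto
    then show False using assms by (simp add: null_sets_def)
  qed
  moreover have "gamma_mean 1 (tent u v) \<ge> 0"
    unfolding f(1) by (intro Bochner_Integration.integral_nonneg nonneg)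
  ultimately show ?thesis by simp
qed

text \<open>The two densities differ by the factor
  \<open>t powr (\<rho> - 1) / Gamma \<rho>\<close>, which is nonincreasing in \<open>t\<close>
  because \<open>\<rho> \<le> 1\<close>. On the window it therefore lies between its values at
  \<open>v\<close> and at \<open>u\<close>; both tend to \<open>1 / Gamma \<rho>\<close> when the
  window shrinks to \<open>t = 1\<close>.\<close>

lemma gamma_mean_tent_bounds:
  assumes \<rho>: "0 < \<rho>" "\<rho> \<le> 1" and uv: "0 < u" "u < v"
  shows "v powr (\<rho> - 1) / Gamma \<rho> * gamma_mean 1 (tent u v) \<le> gamma_mean \<rho> (tent u v)"
    and "gamma_mean \<rho> (tent u v) \<le> u powr (\<rho> - 1) / Gamma \<rho> * gamma_mean 1 (tent u v)"
proof -
  let ?f = "\<lambda>\<rho> t. indicator {0..} t * t powr (\<rho> - 1) / exp t / Gamma \<rho> * tent u v (exp (- t))"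
  note f = gamma_mean_tent[of _ u v]
  have G: "Gamma \<rho> > 0" using \<rho> by simp
  have le: "v powr (\<rho> - 1) / Gamma \<rho> * ?f 1 t \<le> ?f \<rho> t \<and>
    ?f \<rho> t \<le> u powr (\<rho> - 1) / Gamma \<rho> * ?f 1 t" for t
  proof (cases "u < t \<and> t < v")
    case True
    define w where "w = tent u v (exp (- t)) / (exp t * Gamma \<rho>)"
    have w: "w \<ge> 0" using G by (simp add: w_def tent_nonneg)
    have "t powr (\<rho> - 1) \<le> u powr (\<rho> - 1)" "v powr (\<rho> - 1) \<le> t powr (\<rho> - 1)"
      using True uv \<rho> by (auto intro!: powr_mono2')
    then have "t powr (\<rho> - 1) * w \<le> u powr (\<rho> - 1) * w" "v powr (\<rho> - 1) * w \<le> t powr (\<rho> - 1) * w"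
      using w by (auto intro: mult_right_mono)
    then show ?thesis using True uv by (simp add: w_def mult_ac)
  next
    case False
    then have "tent u v (exp (- t)) = 0"
      using tent_pos_iff[of u v t] tent_nonneg[of u v "exp (- t)"] by linarith
    then show ?thesis by simp
  qed
  have "(\<integral>t. v powr (\<rho> - 1) / Gamma \<rho> * ?f 1 t \<partial>lborel) \<le> (\<integral>t. ?f \<rho> t \<partial>lborel)"
    using le by (intro integral_mono integrable_mult_right f(2) \<rho> zero_less_one) blast
  then show "v powr (\<rho> - 1) / Gamma \<rho> * gamma_mean 1 (tent u v) \<le> gamma_mean \<rho> (tent u v)"
    unfolding f(1)[OF \<rho>(1)] f(1)[OF zero_less_one] integral_mult_right_zero .
  have "(\<integral>t. ?f \<rho> t \<partial>lborel) \<le> (\<integral>t. u powr (\<rho> - 1) / Gamma \<rho> * ?f 1 t \<partial>lborel)"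
    using le by (intro integral_mono integrable_mult_right f(2) \<rho> zero_less_one) blast
  then show "gamma_mean \<rho> (tent u v) \<le> u powr (\<rho> - 1) / Gamma \<rho> * gamma_mean 1 (tent u v)"
    unfolding f(1)[OF \<rho>(1)] f(1)[OF zero_less_one] integral_mult_right_zero .
qed

text \<open>Monotonicity turns averages into pointwise values. A tent ending at \<open>t = 1\<close>
  sees only indices below \<open>Suc N\<close>, where \<open>a\<close> is at least
  \<open>a (Suc N)\<close>; a tent starting at \<open>1\<close> sees only indices above it. Dividing
  by the same average of the constant sequence \<open>1\<close> removes the shape of the tent, and
  shrinking the window leaves the density factor \<open>1 / Gamma \<rho>\<close>.\<close>

theorem karamata_antimono:
  fixes a :: "nat \<Rightarrow> real"
  assumes \<rho>: "0 < \<rho>" "\<rho> \<le> 1" and nonneg: "\<And>n. 0 \<le> a n" and anti: "decseq a"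
    and lim: "((\<lambda>s. (1 - s) powr \<rho> * (\<Sum>n. a n * s ^ n)) \<longlongrightarrow> c) (at_left 1)"
  shows "(\<lambda>n. a n * real n powr (1 - \<rho>)) \<longlonglongrightarrow> c / Gamma \<rho>"
proof -
  have summ: "summable (\<lambda>n. a n * s ^ n)" if "0 < s" "s < 1" for s
  proof (rule summable_comparison_test')
    show "summable (\<lambda>n. a 0 * s ^ n)"
      using that by (intro summable_mult summable_geometric) simp
    show "norm (a n * s ^ n) \<le> a 0 * s ^ n" if "n \<ge> 0" for n
      using anti nonneg[of n] \<open>0 < s\<close> by (simp add: decseq_def mult_right_mono)
  qed
  have c: "c \<ge> 0"
  proof (rule tendsto_lowerbound[OF lim])
    show "\<forall>\<^sub>F s in at_left 1. 0 \<le> (1 - s) powr \<rho> * (\<Sum>n. a n * s ^ n)"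
      using at_left_1_eventually
      by eventually_elim (auto intro!: mult_nonneg_nonneg suminf_nonneg summ nonneg)
  qed simp
  have G: "Gamma \<rho> > 0" using \<rho> by simp
  \<comment> \<open>This choice places the index \<open>Suc N\<close> exactly at
    \<open>t = 1\<close>, since \<open>s N ^ n = exp (- (n / Suc N))\<close>.\<close>
  define s where "s N = exp (- (1 / real (Suc N)))" for N
  define b where "b N = a (Suc N) * (1 - s N) powr (\<rho> - 1)" for N
  have s: "0 < s N" "s N < 1" for N
    by (auto simp: s_def)
  have s_pow: "s N ^ n = exp (- (real n / real (Suc N)))" for N n
    unfolding s_def by (subst exp_of_nat_mult[symmetric]) simp
  have "(\<lambda>N. s N) \<longlonglongrightarrow> exp (- 0)"
    unfolding s_def by (intro tendsto_intros LIMSEQ_Suc[OF lim_1_over_n])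
  then have fs: "filterlim s (at_left 1) sequentially"
    using s by (intro tendsto_imp_filterlim_at_left) auto
  define A where "A f N = (1 - s N) powr \<rho> * (\<Sum>n. a n * s N ^ n * f (s N ^ n))" for f N
  \<comment> \<open>The corresponding average of the constant sequence \<open>1\<close>, to which
    the continuous theorem applies with exponent \<open>1\<close> and limit
    \<open>1\<close>.\<close>
  define I where "I f N = (1 - s N) * (\<Sum>n. s N ^ n * f (s N ^ n))" for f N
  have A: "A f \<longlonglongrightarrow> c * gamma_mean \<rho> f" if "continuous_on UNIV f" for f
    unfolding A_def
    by (rule filterlim_compose[OF karamata_continuous[OF \<rho>(1) nonneg summ lim that] fs])
  have I: "I f \<longlonglongrightarrow> gamma_mean 1 f" if "continuous_on UNIV f" for f
  proof -
    have "((\<lambda>s::real. (1 - s) powr 1 * (\<Sum>n. 1 * s ^ n)) \<longlongrightarrow> 1) (at_left 1)"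
    proof (rule Lim_transform_eventually[OF tendsto_const])
      show "\<forall>\<^sub>F s::real in at_left 1. 1 = (1 - s) powr 1 * (\<Sum>n. 1 * s ^ n)"
        using at_left_1_eventually by eventually_elim (simp add: suminf_geometric)
    qed
    from karamata_continuous[OF zero_less_one _ _ this that]
    have "((\<lambda>s. (1 - s) powr 1 * (\<Sum>n. 1 * s ^ n * f (s ^ n))) \<longlongrightarrow> 1 * gamma_mean 1 f) (at_left 1)"
      by (simp add: summable_geometric)
    from filterlim_compose[OF this fs] show ?thesis
      using s by (simp add: I_def[abs_def] less_imp_le)
  qed
  have sumA: "summable (\<lambda>n. a n * s N ^ n * tent u v (s N ^ n))" for N u v
    by (intro summable_power_test_function continuous_tent s nonneg summ)
  have sumI: "summable (\<lambda>n. s N ^ n * tent u v (s N ^ n))" for N u v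
    using summable_power_test_function[of "tent u v" "s N" "\<lambda>_. 1"] s[of N]
    by (simp add: continuous_tent summable_geometric)
  have AI: "b N * I f N = (1 - s N) powr \<rho> * (\<Sum>n. a (Suc N) * (s N ^ n * f (s N ^ n)))"
    if "summable (\<lambda>n. s N ^ n * f (s N ^ n))" for f N
  proof -
    have "(1 - s N) powr \<rho> = (1 - s N) powr (\<rho> - 1) * (1 - s N)"
      using s[of N] by (simp add: powr_diff)
    then show ?thesis
      using suminf_mult[OF that] by (simp add: b_def I_def)
  qed
  have upper: "b N * I (tent u 1) N \<le> A (tent u 1) N" if "0 < u" "u < 1" for u N
  proof -
    have "a (Suc N) * (s N ^ n * tent u 1 (s N ^ n)) \<le> a n * s N ^ n * tent u 1 (s N ^ n)" for n
    proof (cases "tent u 1 (s N ^ n) > 0")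
      case True
      then have "n < Suc N" by (simp add: s_pow tent_pos_iff)
      then have "a (Suc N) \<le> a n" using anti by (simp add: decseq_def)
      then have "a (Suc N) * (s N ^ n * tent u 1 (s N ^ n)) \<le> a n * (s N ^ n * tent u 1 (s N ^ n))"
        using s[of N] tent_nonneg by (intro mult_right_mono mult_nonneg_nonneg) auto
      then show ?thesis by (simp add: mult.assoc)
    next
      case False
      then have "tent u 1 (s N ^ n) = 0" using tent_nonneg[of u 1 "s N ^ n"] by linarith
      then show ?thesis by simp
    qed
    then have "(\<Sum>n. a (Suc N) * (s N ^ n * tent u 1 (s N ^ n))) \<le> (\<Sum>n. a n * s N ^ n * tent u 1 (s N ^ n))"
      by (intro suminf_le summable_mult sumI sumA)
    then show ?thesis
      unfolding AI[OF sumI] A_def by (rule mult_left_mono) simp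
  qed
  have lower: "A (tent 1 v) N \<le> b N * I (tent 1 v) N" if "1 < v" for v N
  proof -
    have "a n * s N ^ n * tent 1 v (s N ^ n) \<le> a (Suc N) * (s N ^ n * tent 1 v (s N ^ n))" for n
    proof (cases "tent 1 v (s N ^ n) > 0")
      case True
      then have "Suc N < n" by (simp add: s_pow tent_pos_iff)
      then have "a n \<le> a (Suc N)" using anti by (simp add: decseq_def)
      then have "a n * (s N ^ n * tent 1 v (s N ^ n)) \<le> a (Suc N) * (s N ^ n * tent 1 v (s N ^ n))"
        using s[of N] tent_nonneg by (intro mult_right_mono mult_nonneg_nonneg) auto
      then show ?thesis by (simp add: mult.assoc)
    next
      case False
      then have "tent 1 v (s N ^ n) = 0" using tent_nonneg[of 1 v "s N ^ n"] by linarith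
      then show ?thesis by simp
    qed
    then have "(\<Sum>n. a n * s N ^ n * tent 1 v (s N ^ n)) \<le> (\<Sum>n. a (Suc N) * (s N ^ n * tent 1 v (s N ^ n)))"
      by (intro suminf_le summable_mult sumI sumA)
    then show ?thesis
      unfolding AI[OF sumI] A_def by (rule mult_left_mono) simp
  qed
  have cont: "((\<lambda>u. c * (u powr (\<rho> - 1) / Gamma \<rho>)) \<longlongrightarrow> c * (1 powr (\<rho> - 1) / Gamma \<rho>)) (at 1 within S)" for S
    using G by (intro tendsto_intros) auto
  have b_lim: "b \<longlonglongrightarrow> c / Gamma \<rho>"
  proof (rule order_tendstoI)
    fix y assume "c / Gamma \<rho> < y"
    \<comment> \<open>The window is taken so short that its cruder density bound, the one at the end
      \<open>u\<close>, already stays below \<open>y\<close>.\<close>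
    then have "\<forall>\<^sub>F u in at_left 1. c * (u powr (\<rho> - 1) / Gamma \<rho>) < y"
      using order_tendstoD(2)[OF cont[of "{..<1}"], of y] by simp
    with at_left_1_eventually
    have "\<forall>\<^sub>F u in at_left 1. (0 < u \<and> u < 1) \<and> c * (u powr (\<rho> - 1) / Gamma \<rho>) < y"
      by eventually_elim auto
    then obtain u where u: "0 < u" "u < 1" "c * (u powr (\<rho> - 1) / Gamma \<rho>) < y"
      by (auto dest!: eventually_happens simp: trivial_limit_at_left_real)
    let ?f = "tent u 1"
    have pos: "gamma_mean 1 ?f > 0" using u by (simp add: gamma_mean_tent_pos)
    have "(\<lambda>N. A ?f N / I ?f N) \<longlonglongrightarrow> c * gamma_mean \<rho> ?f / gamma_mean 1 ?f"
      using pos by (intro tendsto_divide A I continuous_tent) auto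
    moreover have "c * gamma_mean \<rho> ?f / gamma_mean 1 ?f < y"
    proof -
      have "c * gamma_mean \<rho> ?f \<le> c * (u powr (\<rho> - 1) / Gamma \<rho> * gamma_mean 1 ?f)"
        using c u \<rho> by (intro mult_left_mono gamma_mean_tent_bounds) auto
      also have "\<dots> < y * gamma_mean 1 ?f"
        using mult_strict_right_mono[OF u(3) pos] by (simp only: mult.assoc)
      finally show ?thesis using pos by (simp add: pos_divide_less_eq)
    qed
    ultimately have "\<forall>\<^sub>F N in sequentially. A ?f N / I ?f N < y"
      by (rule order_tendstoD)
    moreover have "\<forall>\<^sub>F N in sequentially. I ?f N > 0"
      using I[OF continuous_tent] pos by (rule order_tendstoD)
    ultimately show "\<forall>\<^sub>F N in sequentially. b N < y"
    proof eventually_elim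
      case (elim N)
      then have "b N \<le> A ?f N / I ?f N"
        using upper[OF u(1,2)] by (simp add: pos_le_divide_eq)
      with elim show ?case by linarith
    qed
  next
    fix y assume "y < c / Gamma \<rho>"
    then have "\<forall>\<^sub>F v in at_right 1. y < c * (v powr (\<rho> - 1) / Gamma \<rho>)"
      using order_tendstoD(1)[OF cont[of "{1<..}"], of y] by simp
    moreover have "\<forall>\<^sub>F v::real in at_right 1. 1 < v \<and> v < 2"
      using eventually_at_right_real[of 1 2] by simp
    ultimately have "\<forall>\<^sub>F v in at_right 1. 1 < v \<and> y < c * (v powr (\<rho> - 1) / Gamma \<rho>)"
      by eventually_elim auto
    then obtain v where v: "1 < v" "y < c * (v powr (\<rho> - 1) / Gamma \<rho>)"
      by (auto dest!: eventually_happens simp: trivial_limit_at_right_real)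
    let ?f = "tent 1 v"
    have pos: "gamma_mean 1 ?f > 0" using v by (simp add: gamma_mean_tent_pos)
    have "(\<lambda>N. A ?f N / I ?f N) \<longlonglongrightarrow> c * gamma_mean \<rho> ?f / gamma_mean 1 ?f"
      using pos by (intro tendsto_divide A I continuous_tent) auto
    moreover have "y < c * gamma_mean \<rho> ?f / gamma_mean 1 ?f"
    proof -
      have "y * gamma_mean 1 ?f < c * (v powr (\<rho> - 1) / Gamma \<rho> * gamma_mean 1 ?f)"
        using mult_strict_right_mono[OF v(2) pos] by (simp only: mult.assoc)
      also have "\<dots> \<le> c * gamma_mean \<rho> ?f"
        using c v \<rho> by (intro mult_left_mono gamma_mean_tent_bounds) auto
      finally show ?thesis using pos by (simp add: pos_less_divide_eq)
    qed
    ultimately have "\<forall>\<^sub>F N in sequentially. y < A ?f N / I ?f N"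
      by (rule order_tendstoD)
    moreover have "\<forall>\<^sub>F N in sequentially. I ?f N > 0"
      using I[OF continuous_tent] pos by (rule order_tendstoD)
    ultimately show "\<forall>\<^sub>F N in sequentially. y < b N"
    proof eventually_elim
      case (elim N)
      then have "A ?f N / I ?f N \<le> b N"
        using lower[OF v(1)] by (simp add: pos_divide_le_eq)
      with elim show ?case by linarith
    qed
  qed
  \<comment> \<open>Replaces the normalisation by \<open>1 - s N\<close> with the one by
    \<open>1 / Suc N\<close>.\<close>
  have "(\<lambda>N. (1 - s N) * real (Suc N)) \<longlonglongrightarrow> 1"
  proof -
    have "((\<lambda>n. (1 - exp (- (1 / real n))) * real n) \<longlongrightarrow> 1) sequentially"
      by real_asymp
    then show ?thesis unfolding s_def by (rule LIMSEQ_Suc)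
  qed
  then have "(\<lambda>N. b N * ((1 - s N) * real (Suc N)) powr (1 - \<rho>)) \<longlonglongrightarrow> c / Gamma \<rho> * 1 powr (1 - \<rho>)"
    by (intro tendsto_intros b_lim) auto
  moreover have "b N * ((1 - s N) * real (Suc N)) powr (1 - \<rho>) = a (Suc N) * real (Suc N) powr (1 - \<rho>)" for N
  proof -
    have "(1 - s N) powr (\<rho> - 1) * (1 - s N) powr (1 - \<rho>) = 1"
      using s[of N] by (simp flip: powr_add)
    then show ?thesis by (simp add: b_def powr_mult mult.assoc[symmetric])
  qed
  ultimately have "(\<lambda>N. a (Suc N) * real (Suc N) powr (1 - \<rho>)) \<longlonglongrightarrow> c / Gamma \<rho>"
    by simp
  then show ?thesis by (rule LIMSEQ_imp_Suc)
qed

section \<open>Clusters of descendants\<close>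

text \<open>Keeping only relative heights below \<open>h\<close> makes the set finite, whether or
  not the whole cluster of descendants is.\<close>

primrec trunc_cluster :: "nat \<Rightarrow> (node \<Rightarrow> real) \<Rightarrow> nat \<Rightarrow> node \<Rightarrow> node set" where
  "trunc_cluster r x 0 v = {}"
| "trunc_cluster r x (Suc h) v =
    (if x v = 1 then insert v (\<Union>i<r. trunc_cluster r x h (i # v)) else {})"

text \<open>The recursion of the total progeny of a branching process. Measurability and generating
  functions are derived from it by induction on \<open>h\<close>; \<open>card_trunc_cluster\<close>
  ties it to actual sets of nodes.\<close>

primrec trunc_size :: "nat \<Rightarrow> (node \<Rightarrow> real) \<Rightarrow> nat \<Rightarrow> node \<Rightarrow> nat" where
  "trunc_size r x 0 v = 0"
| "trunc_size r x (Suc h) v =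
    (if x v = 1 then Suc (\<Sum>i<r. trunc_size r x h (i # v)) else 0)"

definition descendants :: "nat \<Rightarrow> node \<Rightarrow> node set" where
  "descendants r v = (\<lambda>u. u @ v) ` nodes r"

lemma Cons_in_nodes [simp]: "i # v \<in> nodes r \<longleftrightarrow> i < r \<and> v \<in> nodes r"
  by (auto simp: nodes_def)

lemma Nil_in_nodes [simp]: "[] \<in> nodes r"
  by (simp add: nodes_def)

lemma self_in_descendants: "v \<in> descendants r v"
  by (force simp: descendants_def)

lemma descendants_child: "i < r \<Longrightarrow> descendants r (i # v) \<subseteq> descendants r v"
proof (clarsimp simp: descendants_def)
  fix u assume "i < r" "u \<in> nodes r"
  then show "u @ i # v \<in> (\<lambda>u. u @ v) ` nodes r"
    by (intro image_eqI[of _ _ "u @ [i]"]) (auto simp: nodes_def)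
qed

lemma descendants_subset_nodes: "v \<in> nodes r \<Longrightarrow> descendants r v \<subseteq> nodes r"
  by (auto simp: descendants_def nodes_def)

lemma descendants_length: "w \<in> descendants r v \<Longrightarrow> length v \<le> length w"
  by (auto simp: descendants_def)

lemma disjoint_descendants:
  assumes "length u = length v" "u \<noteq> v"
  shows "descendants r u \<inter> descendants r v = {}"
  using assms by (auto simp: descendants_def)

lemma trunc_cluster_descendants: "trunc_cluster r x h v \<subseteq> descendants r v"
proof (induction h arbitrary: v)
  case (Suc h)
  have "(\<Union>i<r. trunc_cluster r x h (i # v)) \<subseteq> descendants r v"
    using Suc.IH descendants_child by blast
  then show ?case using self_in_descendants by auto
qed simp

lemma finite_trunc_cluster: "finite (trunc_cluster r x h v)"
  by (induction h arbitrary: v) auto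

lemma card_trunc_cluster: "card (trunc_cluster r x h v) = trunc_size r x h v"
proof (induction h arbitrary: v)
  case (Suc h)
  let ?C = "\<lambda>i. trunc_cluster r x h (i # v)"
  have "v \<notin> ?C i" for i
    using trunc_cluster_descendants[of r x h "i # v"] descendants_length by fastforce
  moreover have "?C i \<inter> ?C j = {}" if "i \<noteq> j" for i j
    using disjoint_descendants[of "i # v" "j # v" r] that
      trunc_cluster_descendants[of r x h "i # v"] trunc_cluster_descendants[of r x h "j # v"]
    by auto
  ultimately show ?case
    by (simp add: finite_trunc_cluster card_UN_disjoint Suc.IH)
qed simp

lemma trunc_cluster_mono: "h \<le> h' \<Longrightarrow> trunc_cluster r x h v \<subseteq> trunc_cluster r x h' v"
proof (induction h arbitrary: h' v)
  case (Suc h)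
  then obtain k where "h' = Suc k" "h \<le> k" by (cases h') auto
  then show ?case using Suc.IH[of k] by auto
qed simp

lemma trunc_size_mono: "h \<le> h' \<Longrightarrow> trunc_size r x h v \<le> trunc_size r x h' v"
  using card_mono[OF finite_trunc_cluster trunc_cluster_mono] by (simp add: card_trunc_cluster)

lemma trunc_size_cong:
  "(\<And>w. w \<in> descendants r v \<Longrightarrow> x w = y w) \<Longrightarrow> trunc_size r x h v = trunc_size r y h v"
proof (induction h arbitrary: v)
  case (Suc h)
  have "x v = y v"
    using Suc.prems self_in_descendants by blast
  moreover have "(\<Sum>i<r. trunc_size r x h (i # v)) = (\<Sum>i<r. trunc_size r y h (i # v))"
    using Suc.prems descendants_child by (intro sum.cong refl Suc.IH) blast
  ultimately show ?case by simp
qed simp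

text \<open>If a node of relative height \<open>h\<close> is reached, then so is the whole path leading to it.\<close>

lemma trunc_size_stable_or_large:
  "trunc_size r x (Suc h) v = trunc_size r x h v \<or> h \<le> trunc_size r x h v"
proof (induction h arbitrary: v)
  case (Suc h)
  show ?case
  proof (cases "\<forall>i<r. trunc_size r x (Suc h) (i # v) = trunc_size r x h (i # v)")
    case True
    then have "(\<Sum>i<r. trunc_size r x (Suc h) (i # v)) = (\<Sum>i<r. trunc_size r x h (i # v))"
      by (intro sum.cong) auto
    then show ?thesis by simp
  next
    case False
    then obtain i where "i < r" "h \<le> trunc_size r x h (i # v)"
      using Suc.IH by blast
    moreover have "trunc_size r x h (i # v) \<le> (\<Sum>j<r. trunc_size r x h (j # v))"
      using \<open>i < r\<close> by (intro member_le_sum) auto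
    ultimately show ?thesis by auto
  qed
qed simp

text \<open>Height \<open>Suc n\<close> decides whether the full cluster of descendants has more
  than \<open>n\<close> nodes: by \<open>trunc_size_stable_or_large\<close>, a cluster that still
  grows beyond this height already has at least \<open>Suc n\<close> nodes within it.\<close>

definition large :: "nat \<Rightarrow> (node \<Rightarrow> real) \<Rightarrow> nat \<Rightarrow> node \<Rightarrow> bool" where
  "large r x n v \<longleftrightarrow> n < trunc_size r x (Suc n) v"

lemma large_iff:
  assumes "n < h"
  shows "large r x n v \<longleftrightarrow> n < trunc_size r x h v"
proof -
  have "n < trunc_size r x (Suc n) v \<longleftrightarrow> n < trunc_size r x (Suc n + k) v" for k
  proof (induction k)
    case (Suc k)
    then show ?case
      using trunc_size_stable_or_large[of r x "Suc n + k" v]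
        trunc_size_mono[of "Suc n + k" "Suc (Suc n + k)" r x v] by auto
  qed simp
  from this[of "h - Suc n"] assms show ?thesis
    by (simp add: large_def)
qed

lemma large_if: "n < trunc_size r x h v \<Longrightarrow> large r x n v"
  using large_iff[of n "max h (Suc n)" r x v] trunc_size_mono[of h "max h (Suc n)" r x v]
  by (auto simp del: trunc_size.simps)

lemma large_open: "large r x n v \<Longrightarrow> x v = 1"
  by (auto simp: large_def split: if_splits)

lemma large_child: "x v = 1 \<Longrightarrow> i < r \<Longrightarrow> large r x n (i # v) \<Longrightarrow> large r x n v"
proof (rule large_if[of _ _ _ "Suc (Suc n)"])
  assume *: "x v = 1" "i < r" "large r x n (i # v)"
  then have "trunc_size r x (Suc n) (i # v) \<le> (\<Sum>j<r. trunc_size r x (Suc n) (j # v))"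
    by (intro member_le_sum) auto
  then show "n < trunc_size r x (Suc (Suc n)) v"
    using * by (simp add: large_def del: trunc_size.simps add: trunc_size.simps(2)[of r x "Suc n"])
qed

section \<open>Connected open clusters compared with truncated clusters\<close>

lemma trunc_cluster_open: "w \<in> trunc_cluster r x h v \<Longrightarrow> x w = 1"
  by (induction h arbitrary: v) (auto split: if_splits)

lemma trunc_cluster_connected:
  assumes "w \<in> trunc_cluster r x h v" "v \<in> nodes r"
  shows "(v, w) \<in> (edges r \<inter> trunc_cluster r x h v \<times> trunc_cluster r x h v)\<^sup>*"
  using assms
proof (induction h arbitrary: v)
  case (Suc h)
  let ?T = "\<lambda>h v. trunc_cluster r x h v"
  have v: "x v = 1" using Suc.prems(1) by (auto split: if_splits)
  show ?case
  proof (cases "w = v")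
    case False
    then obtain i where i: "i < r" "w \<in> ?T h (i # v)"
      using Suc.prems(1) by (auto split: if_splits)
    have sub: "?T h (i # v) \<subseteq> ?T (Suc h) v"
      using i(1) v by auto
    have "(i # v, w) \<in> (edges r \<inter> ?T h (i # v) \<times> ?T h (i # v))\<^sup>*"
      using Suc.IH[OF i(2)] i(1) Suc.prems(2) by simp
    then have "(i # v, w) \<in> (edges r \<inter> ?T (Suc h) v \<times> ?T (Suc h) v)\<^sup>*"
      using sub by (elim rtrancl_mono[THEN subsetD, rotated]) blast
    moreover have "(v, i # v) \<in> edges r \<inter> ?T (Suc h) v \<times> ?T (Suc h) v"
    proof -
      have "i # v \<in> ?T h (i # v)"
        using i(2) by (cases h) (auto split: if_splits)
      then have "i # v \<in> ?T (Suc h) v" using sub by blast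
      then show ?thesis
        using Suc.prems(2) i(1) v by (auto simp: edges_def)
    qed
    ultimately show ?thesis by (rule converse_rtrancl_into_rtrancl[rotated])
  qed simp
qed simp

lemma edges_sym: "sym (edges r \<inter> A \<times> A)"
  by (auto simp: sym_def edges_def)

text \<open>Makes truncated clusters competitors in the supremum defining \<open>K\<close>. Two
  nodes are joined through \<open>v\<close>, which is the root because every proper descendant is a
  longer word.\<close>

lemma cluster_trunc_cluster:
  assumes "v \<in> nodes r" "trunc_cluster r x h v \<noteq> {}"
  shows "cluster r (trunc_cluster r x h v)" "cluster_root r (trunc_cluster r x h v) = v"
proof -
  let ?T = "trunc_cluster r x h v"
  have "(u, w) \<in> (edges r \<inter> ?T \<times> ?T)\<^sup>*" if "u \<in> ?T" "w \<in> ?T" for u w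
  proof -
    have "(v, u) \<in> (edges r \<inter> ?T \<times> ?T)\<^sup>*" "(v, w) \<in> (edges r \<inter> ?T \<times> ?T)\<^sup>*"
      using that trunc_cluster_connected assms(1) by auto
    moreover from this(1) have "(u, v) \<in> (edges r \<inter> ?T \<times> ?T)\<^sup>*"
      using sym_rtrancl[OF edges_sym] by (meson symD)
    ultimately show ?thesis by (meson rtrancl_trans)
  qed
  moreover have sub: "?T \<subseteq> nodes r"
    using trunc_cluster_descendants descendants_subset_nodes assms(1) by blast
  ultimately show c: "cluster r ?T"
    using assms(2) by (auto simp: cluster_def)
  have "v \<in> ?T" using assms(2) by (cases h) auto
  moreover have "gen r v \<le> gen r w" if "w \<in> ?T" for w
    using that sub assms(1) trunc_cluster_descendants[of r x h v] descendants_length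
    by (metis gen_eq_length subsetD)
  ultimately show "cluster_root r ?T = v"
    unfolding cluster_root_def by (intro the1_equality cluster_root_unique[OF c]) auto
qed

lemma mem_trunc_cluster_Suc:
  "w \<in> trunc_cluster r x (Suc h) v \<longleftrightarrow>
    x v = 1 \<and> (w = v \<or> (\<exists>j<r. w \<in> trunc_cluster r x h (j # v)))"
  by auto

lemma trunc_cluster_child:
  assumes "w \<in> trunc_cluster r x h v" "i < r" "x (i # w) = 1"
  shows "i # w \<in> trunc_cluster r x (Suc h) v"
  using assms
proof (induction h arbitrary: v)
  case (Suc h)
  then have v: "x v = 1" "w = v \<or> (\<exists>j<r. w \<in> trunc_cluster r x h (j # v))"
    unfolding mem_trunc_cluster_Suc by blast+
  have "i # v \<in> trunc_cluster r x (Suc h) (i # v)" if "w = v"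
    using that Suc.prems(3) by (simp only: mem_trunc_cluster_Suc) simp
  then have "\<exists>j<r. i # w \<in> trunc_cluster r x (Suc h) (j # v)"
    using v(2) Suc.IH Suc.prems(2,3) by blast
  then show ?case
    using v(1) unfolding mem_trunc_cluster_Suc[of _ r x "Suc h"] by blast
qed simp

lemma trunc_cluster_parent:
  assumes "i # w \<in> trunc_cluster r x h v" "i # w \<noteq> v"
  shows "w \<in> trunc_cluster r x h v"
  using assms
proof (induction h arbitrary: v)
  case (Suc h)
  then obtain j where j: "j < r" "i # w \<in> trunc_cluster r x h (j # v)" "x v = 1"
    unfolding mem_trunc_cluster_Suc by blast
  then show ?case
    using Suc.IH[OF j(2)] unfolding mem_trunc_cluster_Suc by (cases "i # w = j # v") auto
qed simp

text \<open>Follow a path inside \<open>A\<close> from its root. A step to a child costs one more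
  unit of truncation height, a step to a parent costs none.\<close>

lemma open_cluster_subset:
  assumes A: "cluster r A" "open_nodes x A"
  shows "A \<subseteq> (\<Union>h. trunc_cluster r x h (cluster_root r A))"
proof
  define v where "v = cluster_root r A"
  have v: "v \<in> A" "\<And>w. w \<in> A \<Longrightarrow> gen r v \<le> gen r w"
    using theI'[OF cluster_root_unique[OF A(1)]] by (auto simp: v_def cluster_root_def)
  have sub: "A \<subseteq> nodes r" using A(1) by (auto simp: cluster_def)
  fix w assume "w \<in> A"
  then have "(v, w) \<in> (edges r \<inter> A \<times> A)\<^sup>*"
    using v A(1) by (auto simp: cluster_def)
  then have "\<exists>h. w \<in> trunc_cluster r x h v"
  proof (induction rule: rtrancl_induct)
    case base
    have "v \<in> trunc_cluster r x (Suc 0) v"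
      using v A(2) by (auto simp: open_nodes_def)
    then show ?case by blast
  next
    case (step w w')
    then obtain h where h: "w \<in> trunc_cluster r x h v" by blast
    have w: "w \<in> A" "w' \<in> A" "w' \<in> nodes r" "x w' = 1"
      using step.hyps A(2) sub by (auto simp: open_nodes_def)
    have "(\<exists>i. w' = i # w) \<or> (\<exists>i. w = i # w')"
      using step.hyps by (auto simp: edges_def)
    then show ?case
    proof
      assume "\<exists>i. w' = i # w"
      then obtain i where "w' = i # w" by blast
      then show ?thesis using trunc_cluster_child[OF h, of i] w(3,4) by (metis Cons_in_nodes)
    next
      assume "\<exists>i. w = i # w'"
      then obtain i where i: "w = i # w'" by blast
      \<comment> \<open>The parent \<open>w'\<close> also belongs to \<open>A\<close> and has
        smaller generation than \<open>w\<close>, so \<open>w\<close> cannot be the root.\<close>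
      moreover have "w \<noteq> v"
        using v(2)[OF w(2)] gen_eq_length[of v r] gen_eq_length[of w' r] w v(1) sub i by auto
      ultimately show ?thesis using trunc_cluster_parent[of i w' r x h v] h by auto
    qed
  qed
  then show "w \<in> (\<Union>h. trunc_cluster r x h (cluster_root r A))"
    by (simp add: v_def)
qed

text \<open>A supremum over all clusters becomes a condition on the nodes up to level
  \<open>d\<close>. If a cluster is too big, possibly infinite, then \<open>Suc n\<close> of its
  nodes already lie in one truncated cluster at its root, because these truncated clusters form a
  chain.\<close>

lemma K_le_iff:
  "K r x d \<le> enat n \<longleftrightarrow> (\<forall>v\<in>nodes r. length v \<le> d \<longrightarrow> \<not> large r x n v)"
proof
  assume le: "K r x d \<le> enat n"
  show "\<forall>v\<in>nodes r. length v \<le> d \<longrightarrow> \<not> large r x n v"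
  proof (intro ballI impI notI)
    fix v assume v: "v \<in> nodes r" "length v \<le> d" "large r x n v"
    let ?T = "trunc_cluster r x (Suc n) v"
    have card: "n < card ?T"
      using v(3) by (simp add: large_def card_trunc_cluster del: trunc_cluster.simps)
    then have ne: "?T \<noteq> {}" by (metis card.empty not_less_zero)
    have "cluster_size ?T \<le> K r x d"
      unfolding K_def
    proof (intro Sup_upper CollectI exI conjI)
      show "cluster r ?T" using cluster_trunc_cluster(1)[OF v(1) ne] .
      show "open_nodes x ?T" using trunc_cluster_open by (auto simp: open_nodes_def)
      show "cluster_root r ?T \<in> nodes_upto r d"
        unfolding cluster_trunc_cluster(2)[OF v(1) ne]
        using v by (simp add: nodes_upto_def gen_eq_length)
    qed simp
    with le have "cluster_size ?T \<le> enat n" by (rule order_trans[rotated])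
    then show False using card by (simp add: cluster_size_def finite_trunc_cluster del: trunc_cluster.simps)
  qed
next
  assume small: "\<forall>v\<in>nodes r. length v \<le> d \<longrightarrow> \<not> large r x n v"
  show "K r x d \<le> enat n"
    unfolding K_def
  proof (rule Sup_least, clarify)
    fix A assume A: "cluster r A" "open_nodes x A" "cluster_root r A \<in> nodes_upto r d"
    define v where "v = cluster_root r A"
    have v: "v \<in> nodes r" "length v \<le> d"
      using A(3) gen_eq_length by (auto simp: v_def nodes_upto_def)
    show "cluster_size A \<le> enat n"
    proof (rule ccontr)
      assume "\<not> ?thesis"
      then have "infinite A \<or> n < card A"
        by (auto simp: cluster_size_def split: if_splits)
      then obtain B where B: "B \<subseteq> A" "card B = Suc n" "finite B"
      proof (cases "finite A")
        case True
        with \<open>infinite A \<or> n < card A\<close> have "Suc n \<le> card A" by simp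
        then show ?thesis using obtain_subset_with_card_n that by meson
      next
        case False
        then show ?thesis using infinite_arbitrarily_large[of A "Suc n"] that by blast
      qed
      have "B \<subseteq> \<Union> (range (\<lambda>h. trunc_cluster r x h v))"
        using B(1) open_cluster_subset[OF A(1,2)] by (auto simp: v_def)
      moreover have "subset.chain UNIV (range (\<lambda>h. trunc_cluster r x h v))"
      proof -
        have "trunc_cluster r x h v \<subseteq> trunc_cluster r x h' v \<or>
            trunc_cluster r x h' v \<subseteq> trunc_cluster r x h v" for h h'
          using trunc_cluster_mono nat_le_linear by metis
        then show ?thesis
          unfolding subset_chain_def by blast
      qed
      ultimately obtain C where "C \<in> range (\<lambda>h. trunc_cluster r x h v)" "B \<subseteq> C"
        using finite_subset_Union_chain[OF B(3)] by blast
      then obtain h where "B \<subseteq> trunc_cluster r x h v" by blast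
      then have "Suc n \<le> trunc_size r x h v"
        using card_mono[OF finite_trunc_cluster] B(2) by (metis card_trunc_cluster)
      then show False using small v large_if[of n r x h v] by auto
    qed
  qed
qed

lemma log_enat_le_iff:
  assumes "b > 1"
  shows "log_enat b k \<le> ereal y \<longleftrightarrow> k \<le> enat (nat \<lfloor>b powr y\<rfloor>)"
proof (cases k)
  case (enat m)
  show ?thesis
  proof (cases "m = 0")
    case False
    then have "log b (real m) \<le> y \<longleftrightarrow> real m \<le> b powr y"
      using assms by (simp add: log_le_iff)
    also have "\<dots> \<longleftrightarrow> m \<le> nat \<lfloor>b powr y\<rfloor>"
      by (simp add: le_nat_iff le_floor_iff)
    finally show ?thesis using enat False by (simp add: log_enat_def)
  qed (simp add: enat log_enat_def)
qed (simp add: log_enat_def)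

section \<open>Measurability, levels of the tree and elementary estimates\<close>

lemma measurable_trunc_size:
  assumes "\<And>w. w \<in> descendants r v \<Longrightarrow> Y w \<in> borel_measurable N"
  shows "(\<lambda>\<omega>. trunc_size r (\<lambda>w. Y w \<omega>) h v) \<in> measurable N (count_space UNIV)"
  using assms
proof (induction h arbitrary: v)
  case (Suc h)
  have [measurable]: "Y v \<in> borel_measurable N"
    by (rule Suc.prems[OF self_in_descendants])
  have [measurable]: "(\<lambda>\<omega>. trunc_size r (\<lambda>w. Y w \<omega>) h (i # v)) \<in> measurable N (count_space UNIV)"
    if "i \<in> {..<r}" for i
    using that by (intro Suc.IH Suc.prems) (auto dest: descendants_child[THEN subsetD])
  show ?case by simp
qed simp

lemma measurable_trunc_size_PiM [measurable]:
  "(\<lambda>x. trunc_size r x h v) \<in> measurable (PiM (descendants r v) (\<lambda>_. borel)) (count_space UNIV)"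
  using measurable_trunc_size[of r v "\<lambda>w x. x w" "PiM (descendants r v) (\<lambda>_. borel)" h]
  by (simp add: measurable_component_singleton)

lemma trunc_size_bounded: "\<exists>B. \<forall>x v. trunc_size r x h v \<le> B"
proof (induction h)
  case (Suc h)
  then obtain B where "trunc_size r x h v \<le> B" for x v by blast
  then have "(\<Sum>i<r. trunc_size r x h (i # v)) \<le> r * B" for x v
    using sum_bounded_above[of "{..<r}" "\<lambda>i. trunc_size r x h (i # v)" B] by simp
  then show ?case by (intro exI[of _ "Suc (r * B)"]) auto
qed auto

definition level :: "nat \<Rightarrow> nat \<Rightarrow> node set" where
  "level r d = {v \<in> nodes r. length v = d}"

lemma finite_level: "finite (level r d)" and card_level: "card (level r d) = r ^ d"
proof -
  have "level r d = {v. set v \<subseteq> {..<r} \<and> length v = d}"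
    by (auto simp: level_def nodes_def)
  then show "finite (level r d)" "card (level r d) = r ^ d"
    by (simp_all add: finite_lists_length_eq card_lists_length_eq)
qed

lemma sum_power_less:
  assumes "r \<ge> (2::nat)"
  shows "(\<Sum>k<d. r ^ k) \<le> r ^ d"
proof (induction d)
  case (Suc d)
  then have "(\<Sum>k<Suc d. r ^ k) \<le> 2 * r ^ d" by simp
  also have "\<dots> \<le> r ^ Suc d" using assms by simp
  finally show ?case .
qed simp

text \<open>The double sum is the quotient by \<open>y\<^sup>2\<close> of the second order Taylor remainder of
  \<open>(1 - y) ^ r\<close>.\<close>

definition remainder :: "nat \<Rightarrow> real \<Rightarrow> real" where
  "remainder r y = (\<Sum>j<r. \<Sum>i<j. (1 - y) ^ i)"

lemma power_eq_remainder: "(1 - y) ^ r = 1 - real r * y + y ^ 2 * remainder r y"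
proof (induction r)
  case (Suc r)
  have "1 - (1 - y) ^ r = y * (\<Sum>i<r. (1 - y) ^ i)"
    using one_diff_power_eq[of "1 - y" r] by simp
  then have e: "(1 - y) ^ r = 1 - y * (\<Sum>i<r. (1 - y) ^ i)"
    by simp
  have "(1 - y) ^ Suc r = (1 - y) ^ r - y * (1 - y) ^ r"
    by (simp add: left_diff_distrib)
  also have "y * (1 - y) ^ r = y * (1 - y * (\<Sum>i<r. (1 - y) ^ i))"
    by (simp only: e)
  finally have f: "(1 - y) ^ Suc r = (1 - y) ^ r - y + y ^ 2 * (\<Sum>i<r. (1 - y) ^ i)"
    by (simp add: power2_eq_square right_diff_distrib)
  show ?case unfolding f Suc.IH by (simp add: remainder_def algebra_simps)
qed (simp add: remainder_def)

text \<open>For \<open>r \<ge> 2\<close> the summand with \<open>j = 1\<close> is present and equals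
  \<open>1\<close>. This keeps the quadratic coefficient of the fixed point equation away from
  zero.\<close>

lemma remainder_ge_1:
  assumes "r \<ge> 2" "y \<le> 1"
  shows "remainder r y \<ge> 1"
proof -
  have "(\<Sum>i<1. (1 - y) ^ i) \<le> remainder r y"
    unfolding remainder_def using assms
    by (intro member_le_sum[of 1 "{..<r}" "\<lambda>j. \<Sum>i<j. (1 - y) ^ i"] sum_nonneg) auto
  then show ?thesis by simp
qed

lemma remainder_0: "remainder r 0 = real r * (real r - 1) / 2"
proof -
  have "remainder r 0 = (\<Sum>j<r. real j)"
    by (simp add: remainder_def)
  also have "\<dots> = real r * (real r - 1) / 2"
    by (induction r) (auto simp: field_simps)
  finally show ?thesis .
qed

lemma remainder_le:
  assumes "0 \<le> y" "y \<le> 1"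
  shows "remainder r y \<le> real r ^ 2"
proof -
  have "(\<Sum>i<j. (1 - y) ^ i) \<le> real j" for j
    using sum_bounded_above[of "{..<j}" "\<lambda>i. (1 - y) ^ i" 1] assms by (simp add: power_le_one)
  then have "(\<Sum>i<j. (1 - y) ^ i) \<le> real r" if "j < r" for j
    using that by (meson less_imp_le of_nat_le_iff order_trans)
  then show ?thesis
    unfolding remainder_def
    using sum_bounded_above[of "{..<r}" "\<lambda>j. \<Sum>i<j. (1 - y) ^ i" "real r"]
    by (simp add: power2_eq_square)
qed

lemma tendsto_remainder [tendsto_intros]:
  "(f \<longlongrightarrow> y) F \<Longrightarrow> ((\<lambda>x. remainder r (f x)) \<longlongrightarrow> remainder r y) F"
  unfolding remainder_def by (intro tendsto_intros)

text \<open>Raise \<open>exp (- (a / (1 - a))) \<le> 1 - a \<le> exp (- a)\<close> to the power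
  \<open>m n\<close>; both bounds have the same limit since \<open>a\<close> tends to
  \<open>0\<close>.\<close>

lemma tendsto_one_minus_power:
  fixes a :: "nat \<Rightarrow> real" and m :: "nat \<Rightarrow> nat"
  assumes a: "\<And>n. 0 \<le> a n" "a \<longlonglongrightarrow> 0" and lim: "(\<lambda>n. real (m n) * a n) \<longlonglongrightarrow> l"
  shows "(\<lambda>n. (1 - a n) ^ m n) \<longlonglongrightarrow> exp (- l)"
proof (rule tendsto_sandwich[where f = "\<lambda>n. exp (- (real (m n) * a n / (1 - a n)))"
      and h = "\<lambda>n. exp (- (real (m n) * a n))"])
  have small: "\<forall>\<^sub>F n in sequentially. a n < 1"
    using order_tendstoD(2)[OF a(2)] by simp
  show "\<forall>\<^sub>F n in sequentially. (1 - a n) ^ m n \<le> exp (- (real (m n) * a n))"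
    using small
  proof eventually_elim
    case (elim n)
    have "(1 - a n) ^ m n \<le> exp (- a n) ^ m n"
      using elim exp_ge_add_one_self[of "- a n"] by (intro power_mono) auto
    then show ?case by (simp flip: exp_of_nat_mult)
  qed
  show "(\<lambda>n. exp (- (real (m n) * a n))) \<longlonglongrightarrow> exp (- l)"
    by (intro tendsto_intros lim)
  show "\<forall>\<^sub>F n in sequentially. exp (- (real (m n) * a n / (1 - a n))) \<le> (1 - a n) ^ m n"
    using small
  proof eventually_elim
    case (elim n)
    have "1 / (1 - a n) \<le> exp (a n / (1 - a n))"
      using elim exp_ge_add_one_self[of "a n / (1 - a n)"] by (simp add: field_simps)
    then have "exp (- (a n / (1 - a n))) \<le> 1 - a n"
      using elim by (simp add: exp_minus field_simps)
    then have "exp (- (a n / (1 - a n))) ^ m n \<le> (1 - a n) ^ m n"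
      by (intro power_mono) auto
    then show ?case by (simp flip: exp_of_nat_mult)
  qed
  have "(\<lambda>n. exp (- (real (m n) * a n / (1 - a n)))) \<longlonglongrightarrow> exp (- (l / (1 - 0)))"
    by (intro tendsto_intros lim a(2)) simp
  then show "(\<lambda>n. exp (- (real (m n) * a n / (1 - a n)))) \<longlonglongrightarrow> exp (- l)"
    by simp
qed

section \<open>Critical percolation\<close>

locale critical_percolation = prob_space M
  for M :: "'a measure" +
  fixes X :: "node \<Rightarrow> 'a \<Rightarrow> real" and r :: nat
  assumes r: "r \<ge> 2"
    and indep: "indep_vars (\<lambda>_. borel) X (nodes r)"
    and prob_open: "\<And>v. v \<in> nodes r \<Longrightarrow> prob {\<omega> \<in> space M. X v \<omega> = 1} = 1 / real r"
begin

definition csize :: "nat \<Rightarrow> node \<Rightarrow> 'a \<Rightarrow> nat" where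
  "csize h v \<omega> = trunc_size r (\<lambda>w. X w \<omega>) h v"

definition big :: "nat \<Rightarrow> node \<Rightarrow> 'a \<Rightarrow> bool" where
  "big n v \<omega> = large r (\<lambda>w. X w \<omega>) n v"

lemma measurable_X [measurable]: "v \<in> nodes r \<Longrightarrow> X v \<in> borel_measurable M"
  using indep by (auto simp: indep_vars_def)

lemma measurable_csize [measurable]:
  "v \<in> nodes r \<Longrightarrow> csize h v \<in> measurable M (count_space UNIV)"
  unfolding csize_def[abs_def]
  by (rule measurable_trunc_size) (use descendants_subset_nodes in \<open>auto intro: measurable_X\<close>)

lemma big_eq: "big n v \<omega> \<longleftrightarrow> n < csize (Suc n) v \<omega>"
  by (simp add: big_def large_def csize_def)

lemma measurable_big [measurable]: "v \<in> nodes r \<Longrightarrow> Measurable.pred M (big n v)"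
  unfolding big_eq[abs_def] by measurable

text \<open>Functionals reading disjoint sets of nodes are independent. Locality mediates between
  the whole configuration, in which they are written, and its restriction to \<open>J w\<close>,
  which lives in the product space where measurability is stated.\<close>

lemma indep_local:
  assumes sub: "\<And>w. w \<in> L \<Longrightarrow> J w \<subseteq> nodes r" and disj: "disjoint_family_on J L"
    and meas: "\<And>w. w \<in> L \<Longrightarrow> \<Phi> w \<in> measurable (PiM (J w) (\<lambda>_. borel)) (N w)"
    and loc: "\<And>w x. w \<in> L \<Longrightarrow> \<Phi> w (restrict x (J w)) = \<Phi> w x"
  shows "indep_vars N (\<lambda>w \<omega>. \<Phi> w (\<lambda>v. X v \<omega>)) L"
proof -
  have "indep_vars (\<lambda>w. PiM (J w) (\<lambda>_. borel)) (\<lambda>w \<omega>. restrict (\<lambda>v. X v \<omega>) (J w)) L"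
    by (rule indep_vars_restrict[OF indep sub disj])
  from indep_vars_compose2[OF this meas]
  have "indep_vars N (\<lambda>w \<omega>. \<Phi> w (restrict (\<lambda>v. X v \<omega>) (J w))) L" .
  then show ?thesis
    by (rule indep_vars_cong[THEN iffD1, rotated 3]) (simp_all add: loc)
qed

lemma trunc_size_restrict: "trunc_size r (restrict x (descendants r v)) h v = trunc_size r x h v"
  by (rule trunc_size_cong) simp

text \<open>The branching property, as a single family: the index \<open>v\<close> reads its own
  coordinate, the index \<open>i # v\<close> reads the subtree below that child. Leaving
  \<open>f\<close> and \<open>g\<close> free serves both generating functions and probabilities of
  large clusters.\<close>

lemma indep_node_children:
  assumes v: "v \<in> nodes r" and [measurable]: "f \<in> borel_measurable borel"
  shows "indep_vars (\<lambda>_. borel)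
    (\<lambda>w \<omega>. if w = v then f (X v \<omega>) else g (csize h w \<omega>) :: real) (insert v ((\<lambda>i. i # v) ` {..<r}))"
proof -
  let ?L = "insert v ((\<lambda>i. i # v) ` {..<r})"
  define J where "J w = (if w = v then {v} else descendants r w)" for w
  define \<Phi> where "\<Phi> w x = (if w = v then f (x v) else g (trunc_size r x h w))" for w x
  have "indep_vars (\<lambda>_. borel) (\<lambda>w \<omega>. \<Phi> w (\<lambda>v. X v \<omega>)) ?L"
  proof (rule indep_local)
    show "J w \<subseteq> nodes r" if "w \<in> ?L" for w
      using that v descendants_subset_nodes[of w r] by (auto simp: J_def)
    have "v \<notin> descendants r (i # v)" for i
      using descendants_length by fastforce
    moreover have "descendants r (i # v) \<inter> descendants r (j # v) = {}" if "i \<noteq> j" for i j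
      using that by (intro disjoint_descendants) auto
    ultimately show "disjoint_family_on J ?L"
      unfolding disjoint_family_on_def J_def by auto
    show "\<Phi> w \<in> borel_measurable (PiM (J w) (\<lambda>_. borel))" for w
    proof (cases "w = v")
      case True
      have [measurable]: "(\<lambda>x. x v) \<in> borel_measurable (PiM {v} (\<lambda>_. borel))"
        by (rule measurable_component_singleton) simp
      show ?thesis unfolding \<Phi>_def[abs_def] J_def using True by simp
    next
      case False
      then show ?thesis
        unfolding \<Phi>_def[abs_def] J_def by simp
    qed
    show "\<Phi> w (restrict x (J w)) = \<Phi> w x" for w x
      by (simp add: \<Phi>_def J_def trunc_size_restrict)
  qed
  then show ?thesis by (simp add: \<Phi>_def csize_def cong: if_cong)
qed

section \<open>Generating functions and the common law of the cluster sizes\<close>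

primrec pgf :: "nat \<Rightarrow> real \<Rightarrow> real" where
  "pgf 0 s = 1"
| "pgf (Suc h) s = 1 - 1 / real r + s / real r * pgf h s ^ r"

lemma expectation_open:
  assumes v: "v \<in> nodes r"
  shows "expectation (\<lambda>\<omega>. of_bool (X v \<omega> = 1)) = 1 / real r"
proof -
  have "expectation (\<lambda>\<omega>. of_bool (X v \<omega> = 1)) = expectation (indicator {\<omega> \<in> space M. X v \<omega> = 1})"
    by (intro Bochner_Integration.integral_cong) (auto simp: indicator_def)
  also have "\<dots> = 1 / real r"
    using v prob_open by (simp add: measurable_X)
  finally show ?thesis .
qed

lemma integrable_csize:
  fixes g :: "nat \<Rightarrow> real"
  assumes v: "v \<in> nodes r"
  shows "integrable M (\<lambda>\<omega>. g (csize h v \<omega>))"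
proof -
  obtain B where B: "csize h v \<omega> \<le> B" for \<omega>
    using trunc_size_bounded[of r h] by (auto simp: csize_def)
  show ?thesis
  proof (rule integrable_const_bound[where B = "Max ((\<lambda>k. \<bar>g k\<bar>) ` {..B})"])
    show "AE \<omega> in M. norm (g (csize h v \<omega>)) \<le> Max ((\<lambda>k. \<bar>g k\<bar>) ` {..B})"
      using B by (intro AE_I2) (auto intro!: Max_ge)
  qed (use v in measurable)
qed

lemma prod_node_children:
  "(\<Prod>w\<in>insert v ((\<lambda>i. i # v) ` {..<r}). F w) = F v * (\<Prod>i<r. F (i # v))"
  by (subst prod.insert) (auto simp: prod.reindex inj_on_def)

lemma expectation_pgf:
  assumes "v \<in> nodes r"
  shows "expectation (\<lambda>\<omega>. s ^ csize h v \<omega>) = pgf h s"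
  using assms
proof (induction h arbitrary: v)
  case 0
  then show ?case by (simp add: csize_def prob_space)
next
  case (Suc h)
  let ?L = "insert v ((\<lambda>i. i # v) ` {..<r})"
  let ?F = "\<lambda>w \<omega>. if w = v then of_bool (X v \<omega> = 1) else s ^ csize h w \<omega> :: real"
  have ind: "indep_vars (\<lambda>_. borel) ?F ?L"
    using indep_node_children[OF Suc.prems, of "\<lambda>x. of_bool (x = 1)" "\<lambda>k. s ^ k" h] by simp
  have op: "integrable M (\<lambda>\<omega>. of_bool (X v \<omega> = 1) :: real)"
    using Suc.prems by (intro integrable_const_bound[where B = 1]) auto
  have int: "integrable M (?F w)" if "w \<in> ?L" for w
    using that Suc.prems op by (auto intro!: integrable_csize[of _ "\<lambda>k. s ^ k"])
  have fin: "finite ?L" by simp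
  have E: "expectation (\<lambda>\<omega>. \<Prod>w\<in>?L. ?F w \<omega>) = (\<Prod>w\<in>?L. expectation (?F w))"
    by (rule indep_vars_lebesgue_integral[OF fin ind int])
  have I: "integrable M (\<lambda>\<omega>. \<Prod>w\<in>?L. ?F w \<omega>)"
    by (rule indep_vars_integrable[OF fin ind int])
  \<comment> \<open>A closed node has size \<open>0\<close> and contributes \<open>1\<close>; an
    open node contributes one factor \<open>s\<close> for itself and the product over its
    children.\<close>
  have "s ^ csize (Suc h) v \<omega> = 1 - of_bool (X v \<omega> = 1) + s * (\<Prod>w\<in>?L. ?F w \<omega>)" for \<omega>
    unfolding prod_node_children by (simp add: csize_def power_sum)
  then have "expectation (\<lambda>\<omega>. s ^ csize (Suc h) v \<omega>) =
      1 - 1 / real r + s * (\<Prod>w\<in>?L. expectation (?F w))"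
    using op I by (simp add: E prob_space expectation_open[OF Suc.prems] del: prod.insert)
  also have "(\<Prod>w\<in>?L. expectation (?F w)) = 1 / real r * (\<Prod>i<r. pgf h s)"
    unfolding prod_node_children using Suc.prems
    by (intro arg_cong2[where f = "(*)"] prod.cong) (auto simp: expectation_open Suc.IH)
  finally show ?case by simp
qed

text \<open>The law of \<^term>\<open>csize h v\<close> does not depend on \<^term>\<open>v\<close>, because its generating
  polynomial does not.\<close>

lemma prob_csize_eq:
  assumes "v \<in> nodes r" "w \<in> nodes r"
  shows "prob {\<omega> \<in> space M. csize h v \<omega> = k} = prob {\<omega> \<in> space M. csize h w \<omega> = k}"
proof -
  obtain B where B: "csize h u \<omega> \<le> B" for u \<omega>
    using trunc_size_bounded[of r h] by (auto simp: csize_def)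
  \<comment> \<open>\<open>B\<close> bounds the size at every node at once, and the maximum ensures
    that the coefficient with index \<open>k\<close> is among those compared.\<close>
  have "(\<Sum>k\<le>max B k. prob {\<omega> \<in> space M. csize h u \<omega> = k} * s ^ k) = pgf h s" if "u \<in> nodes r" for u s
  proof -
    have "pgf h s = expectation (\<lambda>\<omega>. \<Sum>k\<le>max B k. s ^ k * indicator {\<omega> \<in> space M. csize h u \<omega> = k} \<omega>)"
      unfolding expectation_pgf[OF that, symmetric]
    proof (intro Bochner_Integration.integral_cong refl)
      fix \<omega> assume "\<omega> \<in> space M"
      then have "(\<Sum>k\<le>max B k. s ^ k * indicator {\<omega> \<in> space M. csize h u \<omega> = k} \<omega>) =
          (\<Sum>k\<le>max B k. if k = csize h u \<omega> then s ^ k else 0)"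
        by (intro sum.cong) (auto simp: indicator_def)
      also have "\<dots> = s ^ csize h u \<omega>"
        using B[of u \<omega>] by (simp add: max.coboundedI1)
      finally show "s ^ csize h u \<omega> = (\<Sum>k\<le>max B k. s ^ k * indicator {\<omega> \<in> space M. csize h u \<omega> = k} \<omega>)" ..
    qed
    also have "\<dots> = (\<Sum>k\<le>max B k. s ^ k * prob {\<omega> \<in> space M. csize h u \<omega> = k})"
      using that by (subst Bochner_Integration.integral_sum) (auto simp: emeasure_eq_measure)
    finally show ?thesis by (simp add: mult.commute)
  qed
  then have "\<forall>s. (\<Sum>k\<le>max B k. prob {\<omega> \<in> space M. csize h v \<omega> = k} * s ^ k) =
      (\<Sum>k\<le>max B k. prob {\<omega> \<in> space M. csize h w \<omega> = k} * s ^ k)"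
    using assms by simp
  then show ?thesis
    unfolding polyfun_eq_coeffs by simp
qed

lemma prob_csize_greater_eq:
  assumes "v \<in> nodes r" "w \<in> nodes r"
  shows "prob {\<omega> \<in> space M. n < csize h v \<omega>} = prob {\<omega> \<in> space M. n < csize h w \<omega>}"
proof -
  have "prob {\<omega> \<in> space M. n < csize h u \<omega>} = 1 - (\<Sum>k\<le>n. prob {\<omega> \<in> space M. csize h u \<omega> = k})"
    if [measurable]: "u \<in> nodes r" for u
  proof -
    have "{\<omega> \<in> space M. n < csize h u \<omega>} = space M - (\<Union>k\<le>n. {\<omega> \<in> space M. csize h u \<omega> = k})"
      by auto
    also have "prob \<dots> = 1 - prob (\<Union>k\<le>n. {\<omega> \<in> space M. csize h u \<omega> = k})"
      by (intro prob_compl) measurable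
    also have "prob (\<Union>k\<le>n. {\<omega> \<in> space M. csize h u \<omega> = k}) = (\<Sum>k\<le>n. prob {\<omega> \<in> space M. csize h u \<omega> = k})"
      by (intro finite_measure_finite_Union) (auto simp: disjoint_family_on_def)
    finally show ?thesis .
  qed
  then show ?thesis
    using assms prob_csize_eq[OF assms] by simp
qed

definition q :: "nat \<Rightarrow> real" where
  "q n = prob {\<omega> \<in> space M. big n [] \<omega>}"

lemma prob_big: "v \<in> nodes r \<Longrightarrow> prob {\<omega> \<in> space M. big n v \<omega>} = q n"
  unfolding q_def big_eq by (rule prob_csize_greater_eq) simp_all

lemma q_bounds: "0 \<le> q n" "q n \<le> 1"
  by (simp_all add: q_def)

lemma prob_csize_eq_q: "n < h \<Longrightarrow> prob {\<omega> \<in> space M. n < csize h [] \<omega>} = q n"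
  unfolding q_def big_def csize_def by (subst large_iff[of n h]) simp_all

lemma decseq_q: "decseq q"
proof (rule decseq_SucI)
  fix n
  have "prob {\<omega> \<in> space M. Suc n < csize (Suc (Suc n)) [] \<omega>} \<le> prob {\<omega> \<in> space M. n < csize (Suc (Suc n)) [] \<omega>}"
    by (intro finite_measure_mono) auto
  then show "q (Suc n) \<le> q n"
    by (simp add: prob_csize_eq_q)
qed

text \<open>Take expectations in \<open>1 - s ^ c = (1 - s) * (\<Sum>n<c. s ^ n)\<close> with
  \<open>c\<close> the random size. Passing from point probabilities to tails provides the monotone
  coefficients that the Tauberian theorem requires.\<close>

lemma pgf_tail:
  "pgf h s = 1 - (1 - s) * (\<Sum>n. prob {\<omega> \<in> space M. n < csize h [] \<omega>} * s ^ n)"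
proof -
  obtain B where B: "csize h [] \<omega> \<le> B" for \<omega>
    using trunc_size_bounded[of r h] by (auto simp: csize_def)
  have pt: "s ^ csize h [] \<omega> = 1 - (1 - s) * (\<Sum>n<B. s ^ n * indicator {\<omega> \<in> space M. n < csize h [] \<omega>} \<omega>)"
    if "\<omega> \<in> space M" for \<omega>
  proof -
    have "(\<Sum>n<B. s ^ n * indicator {\<omega> \<in> space M. n < csize h [] \<omega>} \<omega>) = (\<Sum>n<csize h [] \<omega>. s ^ n)"
      using B[of \<omega>] that by (intro sum.mono_neutral_cong_right) (auto simp: indicator_def)
    then show ?thesis
      using one_diff_power_eq[of s "csize h [] \<omega>"] by simp
  qed
  have "pgf h s = expectation (\<lambda>\<omega>. 1 - (1 - s) * (\<Sum>n<B. s ^ n * indicator {\<omega> \<in> space M. n < csize h [] \<omega>} \<omega>))"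
    unfolding expectation_pgf[OF Nil_in_nodes, symmetric]
    by (intro Bochner_Integration.integral_cong refl pt)
  also have "\<dots> = 1 - (1 - s) * (\<Sum>n<B. s ^ n * prob {\<omega> \<in> space M. n < csize h [] \<omega>})"
    by (simp add: prob_space emeasure_eq_measure del: sum_mult_indicator)
  also have "(\<Sum>n<B. s ^ n * prob {\<omega> \<in> space M. n < csize h [] \<omega>}) =
      (\<Sum>n. prob {\<omega> \<in> space M. n < csize h [] \<omega>} * s ^ n)"
  proof (subst suminf_finite[where N = "{..<B}"])
    fix n assume "n \<notin> {..<B}"
    then have "{\<omega> \<in> space M. n < csize h [] \<omega>} = {}" using B by (auto simp: not_less intro: order_trans)
    then show "prob {\<omega> \<in> space M. n < csize h [] \<omega>} * s ^ n = 0"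
      by (simp only: measure_empty mult_zero_left)
  qed (simp_all add: mult.commute)
  finally show ?thesis .
qed

section \<open>Fixed point equation and asymptotics of the tail\<close>

text \<open>The distance from \<open>1\<close> of the generating function of the untruncated cluster
  size. Expressed through tails, it makes sense without first excluding infinite clusters.\<close>

definition gap :: "real \<Rightarrow> real" where
  "gap s = (1 - s) * (\<Sum>n. q n * s ^ n)"

text \<open>Each tail probability is constant in \<open>h\<close> once \<open>h\<close> exceeds its
  index, and \<open>s ^ k\<close> dominates the terms, so Tannery's theorem applies.\<close>

lemma pgf_tendsto:
  assumes s: "0 < s" "s < 1"
  shows "(\<lambda>h. pgf h s) \<longlonglongrightarrow> 1 - gap s"
proof -
  have bound: "norm (prob {\<omega> \<in> space M. k < csize h [] \<omega>} * s ^ k) \<le> s ^ k" for k h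
    using s by (simp add: abs_mult mult_left_le_one_le)
  have "((\<lambda>h. \<Sum>n. prob {\<omega> \<in> space M. n < csize h [] \<omega>} * s ^ n) \<longlongrightarrow> (\<Sum>n. q n * s ^ n)) sequentially"
  proof (rule tannerys_theorem[THEN conjunct2, THEN conjunct2])
    show "((\<lambda>h. prob {\<omega> \<in> space M. k < csize h [] \<omega>} * s ^ k) \<longlongrightarrow> q k * s ^ k) sequentially" for k
    proof (rule tendsto_eventually)
      show "\<forall>\<^sub>F h in sequentially. prob {\<omega> \<in> space M. k < csize h [] \<omega>} * s ^ k = q k * s ^ k"
        using eventually_gt_at_top[of k] by eventually_elim (simp add: prob_csize_eq_q)
    qed
    show "\<forall>\<^sub>F (k, h) in sequentially \<times>\<^sub>F sequentially. norm (prob {\<omega> \<in> space M. k < csize h [] \<omega>} * s ^ k) \<le> s ^ k"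
      using bound by (intro always_eventually) auto
    show "summable (\<lambda>k. s ^ k)" using s by (simp add: summable_geometric)
  qed simp
  then show ?thesis
    unfolding pgf_tail gap_def by (intro tendsto_intros)
qed

text \<open>The recursion for \<open>pgf\<close> in the limit says
  \<open>r * gap s = 1 - s * (1 - gap s) ^ r\<close>. Expanding the power to second order also
  produces \<open>r * gap s\<close>, precisely because the opening probability is
  \<open>1 / r\<close>, and the two cancel.\<close>

lemma gap_fixed_point:
  assumes s: "0 < s" "s < 1"
  shows "gap s ^ 2 * remainder r (gap s) = (1 - s) * (1 - gap s) ^ r"
proof -
  have "(\<lambda>h. pgf (Suc h) s) \<longlonglongrightarrow> 1 - 1 / real r + s / real r * (1 - gap s) ^ r"
    unfolding pgf.simps by (intro tendsto_intros pgf_tendsto s)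
  with LIMSEQ_Suc[OF pgf_tendsto[OF s]]
  have "1 - gap s = 1 - 1 / real r + s / real r * (1 - gap s) ^ r"
    by (rule LIMSEQ_unique)
  then have "gap s = (1 - s * (1 - gap s) ^ r) / real r"
    by (simp add: diff_divide_distrib)
  then have "real r * gap s = 1 - s * (1 - gap s) ^ r"
    using r by (simp add: nonzero_eq_divide_eq mult.commute)
  then show ?thesis
    using power_eq_remainder[of "gap s" r] unfolding left_diff_distrib by linarith
qed

lemma gap_bounds:
  assumes s: "0 < s" "s < 1"
  shows "0 \<le> gap s" "gap s \<le> 1"
proof -
  have sq: "summable (\<lambda>n. q n * s ^ n)"
  proof (rule summable_comparison_test')
    show "summable (\<lambda>n. s ^ n)" using s by (simp add: summable_geometric)
    show "norm (q n * s ^ n) \<le> s ^ n" if "n \<ge> 0" for n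
      using s q_bounds[of n] by (simp add: abs_mult mult_left_le_one_le)
  qed
  then show "0 \<le> gap s"
    unfolding gap_def using s q_bounds by (intro mult_nonneg_nonneg suminf_nonneg) auto
  have "(\<Sum>n. q n * s ^ n) \<le> (\<Sum>n. s ^ n)"
    using s q_bounds sq by (intro suminf_le) (auto simp: summable_geometric mult_left_le_one_le)
  then have "(1 - s) * (\<Sum>n. q n * s ^ n) \<le> (1 - s) * (1 / (1 - s))"
    using s by (intro mult_left_mono) (auto simp: suminf_geometric)
  then show "gap s \<le> 1" using s by (simp add: gap_def)
qed

text \<open>The remainder is at least \<open>1\<close> and \<open>(1 - gap s) ^ r\<close> at most
  \<open>1\<close>, so the fixed point equation gives \<open>(gap s)\<^sup>2 \<le> 1 - s\<close>.
  The remainder may then be evaluated at \<open>0\<close> in the limit.\<close>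

lemma gap_tendsto_0: "(gap \<longlongrightarrow> 0) (at_left 1)"
proof (rule Lim_null_comparison)
  have "((\<lambda>s::real. sqrt (1 - s)) \<longlongrightarrow> sqrt (1 - 1)) (at_left 1)"
    by (intro tendsto_intros)
  then show "((\<lambda>s::real. sqrt (1 - s)) \<longlongrightarrow> 0) (at_left 1)" by simp
  show "\<forall>\<^sub>F s in at_left 1. norm (gap s) \<le> sqrt (1 - s)"
    using at_left_1_eventually
  proof eventually_elim
    case (elim s)
    then have b: "0 \<le> gap s" "gap s \<le> 1" using gap_bounds by auto
    have "gap s ^ 2 * 1 \<le> gap s ^ 2 * remainder r (gap s)"
      using remainder_ge_1[OF r b(2)] by (intro mult_left_mono) auto
    also have "\<dots> \<le> (1 - s) * 1"
      using elim b by (subst gap_fixed_point) (auto intro!: mult_left_mono power_le_one)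
    finally show ?case using b by (simp add: real_le_rsqrt)
  qed
qed

text \<open>Solved for the gap, the fixed point equation gives the limit of
  \<open>gap s / sqrt (1 - s)\<close>. Since the gap is \<open>1 - s\<close> times the power series
  of \<open>q\<close>, this is Karamata's hypothesis with exponent \<open>1 / 2\<close>.\<close>

lemma q_asymp: "(\<lambda>n. q n * sqrt (real n)) \<longlonglongrightarrow> 2 / sqrt (2 * pi * real r * (real r - 1))"
proof -
  have R: "real r * (real r - 1) > 0" using r by simp
  have "((\<lambda>s. sqrt ((1 - gap s) ^ r / remainder r (gap s))) \<longlongrightarrow>
      sqrt ((1 - 0) ^ r / remainder r 0)) (at_left 1)"
    by (intro tendsto_intros gap_tendsto_0) (use R in \<open>simp only: remainder_0; linarith\<close>)
  then have "((\<lambda>s. (1 - s) powr (1 / 2) * (\<Sum>n. q n * s ^ n)) \<longlongrightarrow>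
      sqrt ((1 - 0) ^ r / remainder r 0)) (at_left 1)"
  proof (rule Lim_transform_eventually)
    show "\<forall>\<^sub>F s in at_left 1. sqrt ((1 - gap s) ^ r / remainder r (gap s)) =
        (1 - s) powr (1 / 2) * (\<Sum>n. q n * s ^ n)"
      using at_left_1_eventually
    proof eventually_elim
      case (elim s)
      then have b: "0 \<le> gap s" "gap s \<le> 1" using gap_bounds by auto
      have rem: "remainder r (gap s) > 0"
        using remainder_ge_1[OF r b(2)] by simp
      have "(1 - gap s) ^ r / remainder r (gap s) = gap s ^ 2 / (1 - s)"
        using gap_fixed_point[of s] elim rem by (simp add: field_simps)
      then have "sqrt ((1 - gap s) ^ r / remainder r (gap s)) = gap s / sqrt (1 - s)"
        using b by (simp add: real_sqrt_divide)
      also have "\<dots> = (1 - s) / sqrt (1 - s) * (\<Sum>n. q n * s ^ n)"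
        by (simp add: gap_def)
      also have "(1 - s) / sqrt (1 - s) = (1 - s) powr (1 / 2)"
        using elim by (simp add: real_div_sqrt powr_half_sqrt)
      finally show ?case .
    qed
  qed
  then have "(\<lambda>n. q n * real n powr (1 - 1 / 2)) \<longlonglongrightarrow> sqrt ((1 - 0) ^ r / remainder r 0) / Gamma (1 / 2)"
    by (intro karamata_antimono q_bounds decseq_q) simp_all
  also have "(\<lambda>n. q n * real n powr (1 - 1 / 2)) = (\<lambda>n. q n * sqrt (real n))"
    by (simp add: powr_half_sqrt)
  also have "sqrt ((1 - 0) ^ r / remainder r 0) / Gamma (1 / 2) = sqrt (2 / (real r * (real r - 1)) / pi)"
    by (simp add: remainder_0 Gamma_one_half_real real_sqrt_divide real_sqrt_mult)
  also have "2 / (real r * (real r - 1)) / pi = 2 ^ 2 / (2 * pi * real r * (real r - 1))"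
    by simp
  also have "sqrt \<dots> = 2 / sqrt (2 * pi * real r * (real r - 1))"
    by (simp only: real_sqrt_divide real_sqrt_abs)
  finally show ?thesis .
qed

section \<open>Probability that no cluster is large\<close>

lemma prob_level_small:
  "prob {\<omega> \<in> space M. \<forall>v\<in>level r d. \<not> big n v \<omega>} = (1 - q n) ^ (r ^ d)"
proof -
  have sub: "v \<in> nodes r" if "v \<in> level r d" for v
    using that by (simp add: level_def)
  have ind: "indep_vars (\<lambda>_. count_space UNIV) (\<lambda>w \<omega>. large r (\<lambda>v. X v \<omega>) n w) (level r d)"
  proof (rule indep_local)
    show "descendants r w \<subseteq> nodes r" if "w \<in> level r d" for w
      using that sub descendants_subset_nodes by blast
    show "disjoint_family_on (descendants r) (level r d)"
      unfolding disjoint_family_on_def by (auto simp: level_def intro!: disjoint_descendants)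
    show "(\<lambda>x. large r x n w) \<in> measurable (PiM (descendants r w) (\<lambda>_. borel)) (count_space UNIV)" for w
      unfolding large_def by measurable
    show "large r (restrict x (descendants r w)) n w = large r x n w" for w x
      by (simp add: large_def trunc_size_restrict del: trunc_size.simps)
  qed
  have ne: "level r d \<noteq> {}"
    using card_level[of r d] r by (metis card.empty power_not_zero not_numeral_le_zero)
  have "{\<omega> \<in> space M. \<forall>v\<in>level r d. \<not> big n v \<omega>} =
      (\<Inter>v\<in>level r d. (\<lambda>\<omega>. large r (\<lambda>v. X v \<omega>) n v) -` {False} \<inter> space M)"
    using ne by (auto simp: big_def)
  also have "prob \<dots> = (\<Prod>v\<in>level r d. prob ((\<lambda>\<omega>. large r (\<lambda>v. X v \<omega>) n v) -` {False} \<inter> space M))"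
    by (rule indep_varsD_finite[OF ind ne finite_level]) simp
  also have "\<dots> = (\<Prod>v\<in>level r d. 1 - q n)"
  proof (rule prod.cong[OF refl])
    fix v assume "v \<in> level r d"
    then have v [measurable]: "v \<in> nodes r" by (rule sub)
    have "(\<lambda>\<omega>. large r (\<lambda>v. X v \<omega>) n v) -` {False} \<inter> space M = space M - {\<omega> \<in> space M. big n v \<omega>}"
      by (auto simp: big_def)
    also have "prob \<dots> = 1 - q n"
      by (subst prob_compl) (simp_all add: prob_big[OF v])
    finally show "prob ((\<lambda>\<omega>. large r (\<lambda>v. X v \<omega>) n v) -` {False} \<inter> space M) = 1 - q n" .
  qed
  finally show ?thesis by (simp add: card_level)
qed

text \<open>The indicator is a product over the node and its children, so independence gives an
  exact value. Its expansion in \<open>q n\<close> is what produces the cancellation in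
  \<open>prob_first_big_le\<close>.\<close>

lemma prob_open_children_small:
  assumes v: "v \<in> nodes r"
  shows "prob {\<omega> \<in> space M. X v \<omega> = 1 \<and> (\<forall>i<r. \<not> big n (i # v) \<omega>)} = 1 / real r * (1 - q n) ^ r"
proof -
  let ?L = "insert v ((\<lambda>i. i # v) ` {..<r})"
  let ?F = "\<lambda>w \<omega>. if w = v then of_bool (X v \<omega> = 1) else of_bool (\<not> n < csize (Suc n) w \<omega>) :: real"
  have ind: "indep_vars (\<lambda>_. borel) ?F ?L"
    using indep_node_children[OF v, of "\<lambda>x. of_bool (x = 1)" "\<lambda>k. of_bool (\<not> n < k)" "Suc n"] by simp
  have int: "integrable M (?F w)" if "w \<in> ?L" for w
    using that v by (intro integrable_const_bound[where B = 1]) auto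
  have child: "expectation (?F (i # v)) = 1 - q n" if "i < r" for i
  proof -
    have iv [measurable]: "i # v \<in> nodes r" using that v by simp
    have "expectation (?F (i # v)) = expectation (indicator (space M - {\<omega> \<in> space M. big n (i # v) \<omega>}))"
      by (intro Bochner_Integration.integral_cong) (auto simp: big_eq)
    also have "\<dots> = prob (space M - {\<omega> \<in> space M. big n (i # v) \<omega>})"
      by simp
    also have "\<dots> = 1 - q n"
      by (subst prob_compl) (simp_all add: prob_big[OF iv])
    finally show ?thesis .
  qed
  have [measurable]: "{\<omega> \<in> space M. X v \<omega> = 1 \<and> (\<forall>i<r. \<not> big n (i # v) \<omega>)} \<in> events"
  proof -
    have [measurable]: "i # v \<in> nodes r" if "i \<in> {..<r}" for i using that v by simp
    have "{\<omega> \<in> space M. X v \<omega> = 1 \<and> (\<forall>i\<in>{..<r}. \<not> big n (i # v) \<omega>)} \<in> events"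
      using v by measurable
    then show ?thesis by (simp add: Ball_def)
  qed
  have "prob {\<omega> \<in> space M. X v \<omega> = 1 \<and> (\<forall>i<r. \<not> big n (i # v) \<omega>)} =
      expectation (indicator {\<omega> \<in> space M. X v \<omega> = 1 \<and> (\<forall>i<r. \<not> big n (i # v) \<omega>)})"
    by simp
  also have "\<dots> = expectation (\<lambda>\<omega>. \<Prod>w\<in>?L. ?F w \<omega>)"
  proof (intro Bochner_Integration.integral_cong refl)
    fix \<omega> assume \<omega>: "\<omega> \<in> space M"
    have "(\<Prod>i<r. of_bool (\<not> big n (i # v) \<omega>) :: real) = of_bool (\<forall>i<r. \<not> big n (i # v) \<omega>)"
      by (induction r) (auto simp: less_Suc_eq)
    then show "indicator {\<omega> \<in> space M. X v \<omega> = 1 \<and> (\<forall>i<r. \<not> big n (i # v) \<omega>)} \<omega> = (\<Prod>w\<in>?L. ?F w \<omega>)"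
      unfolding prod_node_children using \<omega> by (simp add: big_eq)
  qed
  also have "\<dots> = (\<Prod>w\<in>?L. expectation (?F w))"
    by (rule indep_vars_lebesgue_integral[OF _ ind int]) simp_all
  also have "\<dots> = 1 / real r * (1 - q n) ^ r"
    unfolding prod_node_children using child by (simp add: expectation_open[OF v])
  finally show ?thesis .
qed

text \<open>By criticality the terms of first order in \<^term>\<open>q n\<close> cancel.\<close>

lemma prob_first_big_le:
  assumes v: "v \<in> nodes r"
  shows "prob {\<omega> \<in> space M. big n v \<omega> \<and> (\<forall>i<r. \<not> big n (i # v) \<omega>)} \<le> real r * q n ^ 2"
proof -
  have [measurable]: "v \<in> nodes r" "\<And>i. i \<in> {..<r} \<Longrightarrow> i # v \<in> nodes r"
    using v by simp_all
  define small where "small \<omega> \<longleftrightarrow> (\<forall>i\<in>{..<r}. \<not> big n (i # v) \<omega>)" for \<omega>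
  have [measurable]: "Measurable.pred M small"
    unfolding small_def[abs_def] by measurable
  have small_iff: "(\<forall>i<r. \<not> big n (i # v) \<omega>) \<longleftrightarrow> small \<omega>" for \<omega>
    by (auto simp: small_def)
  have big: "big n v \<omega> \<Longrightarrow> X v \<omega> = 1" "X v \<omega> = 1 \<Longrightarrow> \<not> small \<omega> \<Longrightarrow> big n v \<omega>" for \<omega>
    using large_open large_child[of "\<lambda>v. X v \<omega>" v _ r n] by (auto simp: big_def small_def)
  \<comment> \<open>An open node with a large child is itself large, so the second event is a
    disjoint part of \<open>big n v\<close>.\<close>
  have "q n = prob ({\<omega> \<in> space M. big n v \<omega> \<and> small \<omega>} \<union> {\<omega> \<in> space M. X v \<omega> = 1 \<and> \<not> small \<omega>})"
    unfolding prob_big[OF v, symmetric] using big by (intro arg_cong[where f = prob]) auto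
  also have "\<dots> = prob {\<omega> \<in> space M. big n v \<omega> \<and> small \<omega>} + prob {\<omega> \<in> space M. X v \<omega> = 1 \<and> \<not> small \<omega>}"
    by (intro finite_measure_Union) auto
  finally have 1: "prob {\<omega> \<in> space M. big n v \<omega> \<and> small \<omega>} = q n - prob {\<omega> \<in> space M. X v \<omega> = 1 \<and> \<not> small \<omega>}"
    by simp
  have "1 / real r = prob ({\<omega> \<in> space M. X v \<omega> = 1 \<and> small \<omega>} \<union> {\<omega> \<in> space M. X v \<omega> = 1 \<and> \<not> small \<omega>})"
    unfolding prob_open[OF v, symmetric] by (intro arg_cong[where f = prob]) auto
  also have "\<dots> = prob {\<omega> \<in> space M. X v \<omega> = 1 \<and> small \<omega>} + prob {\<omega> \<in> space M. X v \<omega> = 1 \<and> \<not> small \<omega>}"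
    by (intro finite_measure_Union) auto
  finally have 2: "prob {\<omega> \<in> space M. X v \<omega> = 1 \<and> \<not> small \<omega>} = 1 / real r - 1 / real r * (1 - q n) ^ r"
    using prob_open_children_small[OF v, of n] by (simp add: small_iff)
  have "prob {\<omega> \<in> space M. big n v \<omega> \<and> small \<omega>} = q n ^ 2 * remainder r (q n) / real r"
    unfolding 1 2 power_eq_remainder using r by (simp add: field_simps)
  also have "\<dots> \<le> q n ^ 2 * real r ^ 2 / real r"
    using remainder_le q_bounds by (intro divide_right_mono mult_left_mono) auto
  also have "\<dots> = real r * q n ^ 2"
    using r by (simp add: power2_eq_square)
  finally show ?thesis by (simp add: small_iff)
qed

definition all_small :: "nat \<Rightarrow> nat \<Rightarrow> 'a set" where
  "all_small d n = {\<omega> \<in> space M. \<forall>k\<in>{..d}. \<forall>v\<in>level r k. \<not> big n v \<omega>}"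

lemma level_small_events: "{\<omega> \<in> space M. \<forall>v\<in>level r k. \<not> big n v \<omega>} \<in> events"
proof (intro sets.sets_Collect_finite_All finite_level)
  fix v assume "v \<in> level r k"
  then have [measurable]: "v \<in> nodes r" by (simp add: level_def)
  show "{\<omega> \<in> space M. \<not> big n v \<omega>} \<in> events" by measurable
qed

lemma all_small_events [measurable]: "all_small d n \<in> events"
  unfolding all_small_def by (intro sets.sets_Collect_finite_All level_small_events) simp

lemma K_le_event: "{\<omega> \<in> space M. K r (\<lambda>v. X v \<omega>) d \<le> enat n} = all_small d n"
  unfolding K_le_iff all_small_def level_def big_def by auto

lemma prob_all_small_le: "prob (all_small d n) \<le> (1 - q n) ^ (r ^ d)"
proof -
  show ?thesis
    unfolding prob_level_small[symmetric]
    by (intro finite_measure_mono level_small_events) (auto simp: all_small_def)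
qed

text \<open>If the deepest node with a large cluster is above level \<open>d\<close>, then none of its children has a
  large cluster.\<close>

lemma prob_all_small_ge:
  "(1 - q n) ^ (r ^ d) - real r ^ d * (real r * q n ^ 2) \<le> prob (all_small d n)"
proof -
  let ?E = "\<lambda>v. {\<omega> \<in> space M. big n v \<omega> \<and> (\<forall>i<r. \<not> big n (i # v) \<omega>)}"
  let ?V = "\<Union>k<d. level r k"
  let ?S = "{\<omega> \<in> space M. \<forall>v\<in>level r d. \<not> big n v \<omega>}"
  have nodes: "v \<in> nodes r" if "v \<in> ?V" for v
    using that by (auto simp: level_def)
  have E: "?E v \<in> events" if "v \<in> nodes r" for v
  proof -
    have [measurable]: "i # v \<in> nodes r" if "i \<in> {..<r}" for i using that \<open>v \<in> nodes r\<close> by simp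
    have "{\<omega> \<in> space M. big n v \<omega> \<and> (\<forall>i\<in>{..<r}. \<not> big n (i # v) \<omega>)} \<in> events"
      using that by measurable
    then show ?thesis by (simp add: Ball_def)
  qed
  have fin: "finite ?V" by (simp add: finite_level)
  have U: "(\<Union>v\<in>?V. ?E v) \<in> events"
    using fin E nodes by (intro sets.finite_UN) auto
  have cover: "?S \<subseteq> all_small d n \<union> (\<Union>v\<in>?V. ?E v)"
  proof
    fix \<omega> assume \<omega>: "\<omega> \<in> ?S"
    show "\<omega> \<in> all_small d n \<union> (\<Union>v\<in>?V. ?E v)"
    proof (cases "\<omega> \<in> all_small d n")
      case False
      define P where "P k \<longleftrightarrow> k \<le> d \<and> (\<exists>v\<in>level r k. big n v \<omega>)" for k
      from False have "\<exists>k. k \<le> d \<and> (\<exists>v\<in>level r k. big n v \<omega>)"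
        using \<omega> by (auto simp: all_small_def)
      then have ex: "\<exists>k. P k" by (simp add: P_def)
      have bound: "P k \<Longrightarrow> k \<le> d" for k by (simp add: P_def)
      define k where "k = Greatest P"
      have "P k"
        unfolding k_def using ex bound by (rule GreatestI_ex_nat)
      then have k: "k \<le> d" "\<exists>v\<in>level r k. big n v \<omega>"
        by (simp_all add: P_def)
      have max: "l \<le> k" if "P l" for l
        unfolding k_def using that bound by (rule Greatest_le_nat)
      obtain v where v: "v \<in> level r k" "big n v \<omega>" using k(2) by blast
      \<comment> \<open>This puts the children of \<open>v\<close> at a level not exceeding
        \<open>d\<close>, where the maximality of \<open>k\<close> applies to them.\<close>
      have "k \<noteq> d" using \<omega> v by auto
      then have "k < d" using k(1) by simp
      moreover have "\<not> big n (i # v) \<omega>" if "i < r" for i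
      proof
        assume "big n (i # v) \<omega>"
        moreover have "i # v \<in> level r (Suc k)" using v(1) that by (simp add: level_def)
        ultimately have "Suc k \<le> k" using \<open>k < d\<close> by (intro max) (auto simp: P_def)
        then show False by simp
      qed
      ultimately have "v \<in> ?V" "\<omega> \<in> ?E v" using v \<omega> by auto
      then show ?thesis by blast
    qed simp
  qed
  have "(1 - q n) ^ (r ^ d) = prob ?S" by (rule prob_level_small[symmetric])
  also have "\<dots> \<le> prob (all_small d n \<union> (\<Union>v\<in>?V. ?E v))"
    using U by (intro finite_measure_mono cover) auto
  also have "\<dots> \<le> prob (all_small d n) + prob (\<Union>v\<in>?V. ?E v)"
    using U by (intro measure_Un_le) auto
  also have "prob (\<Union>v\<in>?V. ?E v) \<le> (\<Sum>v\<in>?V. prob (?E v))"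
    using fin E nodes by (intro measure_UNION_le) auto
  also have "\<dots> \<le> real (card ?V) * (real r * q n ^ 2)"
    using prob_first_big_le nodes by (intro sum_bounded_above) blast
  also have "\<dots> \<le> real r ^ d * (real r * q n ^ 2)"
  proof (intro mult_right_mono)
    have "card ?V \<le> (\<Sum>k<d. card (level r k))" by (intro card_UN_le) simp
    also have "\<dots> \<le> r ^ d" unfolding card_level by (rule sum_power_less[OF r])
    finally show "real (card ?V) \<le> real r ^ d" by (simp flip: of_nat_power)
  qed simp
  finally show ?thesis by simp
qed

section \<open>Scaling and the limit law\<close>

definition C :: real where
  "C = 2 / sqrt (2 * pi * real r * (real r - 1))"

lemma C_pos: "C > 0"
proof -
  have "2 * pi * real r * (real r - 1) > 0" using r by simp
  then show ?thesis by (simp add: C_def)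
qed

definition threshold :: "real \<Rightarrow> nat" where
  "threshold y = nat \<lfloor>real r powr y\<rfloor>"

text \<open>The tail asymptotics along a real parameter, so that each scaling of \<open>d\<close>
  follows by composition. Rounding down costs a factor
  \<open>sqrt (z / \<lfloor>z\<rfloor>)\<close>, which tends to \<open>1\<close>.\<close>

lemma q_threshold:
  "((\<lambda>y. q (threshold y) * real r powr (y / 2)) \<longlongrightarrow> C) at_top"
proof -
  have fl: "filterlim (\<lambda>z::real. nat \<lfloor>z\<rfloor>) sequentially at_top"
    by (rule filterlim_compose[OF filterlim_nat_sequentially filterlim_floor_sequentially])
  have 1: "((\<lambda>z::real. q (nat \<lfloor>z\<rfloor>) * sqrt (real (nat \<lfloor>z\<rfloor>))) \<longlongrightarrow> C) at_top"
    using filterlim_compose[OF q_asymp fl] by (simp add: C_def)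
  have "((\<lambda>z::real. sqrt (z / real_of_int \<lfloor>z\<rfloor>)) \<longlongrightarrow> 1) at_top"
    by real_asymp
  from tendsto_mult[OF 1 this]
  have "((\<lambda>z::real. q (nat \<lfloor>z\<rfloor>) * sqrt (real (nat \<lfloor>z\<rfloor>)) * sqrt (z / real_of_int \<lfloor>z\<rfloor>)) \<longlongrightarrow> C) at_top"
    by simp
  then have 2: "((\<lambda>z::real. q (nat \<lfloor>z\<rfloor>) * sqrt z) \<longlongrightarrow> C) at_top"
  proof (rule Lim_transform_eventually)
    show "\<forall>\<^sub>F z in at_top. q (nat \<lfloor>z\<rfloor>) * sqrt (real (nat \<lfloor>z\<rfloor>)) * sqrt (z / real_of_int \<lfloor>z\<rfloor>) =
        q (nat \<lfloor>z\<rfloor>) * sqrt z"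
      using eventually_ge_at_top[of 1]
    proof eventually_elim
      case (elim z)
      then have "1 \<le> \<lfloor>z\<rfloor>" by simp
      then have "real (nat \<lfloor>z\<rfloor>) = real_of_int \<lfloor>z\<rfloor>" "\<lfloor>z\<rfloor> \<noteq> 0" by linarith+
      then show ?case by (simp flip: real_sqrt_mult)
    qed
  qed
  have "1 < real r" using r by simp
  then have "filterlim (\<lambda>y. real r powr y) at_top at_top"
    by real_asymp
  from filterlim_compose[OF 2 this] show ?thesis
    using r by (simp add: threshold_def powr_half_sqrt_powr)
qed

lemma log_K_event:
  "{\<omega> \<in> space M. log_enat (real r) (K r (\<lambda>v. X v \<omega>) d) \<le> ereal y} = all_small d (threshold y)"
proof -
  have r1: "1 < real r" using r by simp
  show ?thesis
    unfolding log_enat_le_iff[OF r1] threshold_def by (rule K_le_event)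
qed

lemma r_powr: "real r powr real d = real r ^ d"
  using r by (simp add: powr_realpow)

text \<open>The expected number \<open>r ^ d * a d\<close> of large clusters at level
  \<open>d\<close> converges to \<open>C * r powr (- x / 2)\<close>, so the upper bound has the
  desired limit. The correction in the lower bound is \<open>r * (r ^ d * a d) * a d\<close>, a
  bounded quantity times one tending to \<open>0\<close>.\<close>

lemma law_limit:
  "(\<lambda>d. prob {\<omega> \<in> space M. log_enat (real r) (K r (\<lambda>v. X v \<omega>) d) \<le> ereal (2 * real d + x)})
    \<longlonglongrightarrow> exp (- (C * real r powr (- x / 2)))"
proof -
  define a where "a d = q (threshold (2 * real d + x))" for d :: nat
  have top: "filterlim (\<lambda>d. 2 * real d + x) at_top sequentially"
    by real_asymp
  have "(\<lambda>d. a d * real r powr ((2 * real d + x) / 2) * real r powr (- x / 2)) \<longlonglongrightarrow> C * real r powr (- x / 2)"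
    unfolding a_def by (intro tendsto_mult tendsto_const filterlim_compose[OF q_threshold top])
  also have "(\<lambda>d. a d * real r powr ((2 * real d + x) / 2) * real r powr (- x / 2)) = (\<lambda>d. real (r ^ d) * a d)"
  proof
    fix d
    have "real r powr ((2 * real d + x) / 2) * real r powr (- x / 2) = real (r ^ d)"
      by (simp add: add_divide_distrib r_powr flip: powr_add)
    then show "a d * real r powr ((2 * real d + x) / 2) * real r powr (- x / 2) = real (r ^ d) * a d"
      by (simp add: mult.assoc)
  qed
  finally have ra: "(\<lambda>d. real (r ^ d) * a d) \<longlonglongrightarrow> C * real r powr (- x / 2)" .
  have "(\<lambda>d. real (r ^ d) * a d * (1 / real r) ^ d) \<longlonglongrightarrow> C * real r powr (- x / 2) * 0"
    using r by (intro tendsto_mult ra LIMSEQ_power_zero) simp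
  then have a0: "a \<longlonglongrightarrow> 0"
    using r by (simp add: power_one_over)
  have up: "(\<lambda>d. (1 - a d) ^ (r ^ d)) \<longlonglongrightarrow> exp (- (C * real r powr (- x / 2)))"
    using q_bounds by (intro tendsto_one_minus_power a0 ra) (simp add: a_def)
  have "(\<lambda>d. (1 - a d) ^ (r ^ d) - real r * (real (r ^ d) * a d) * a d) \<longlonglongrightarrow>
      exp (- (C * real r powr (- x / 2))) - real r * (C * real r powr (- x / 2)) * 0"
    by (intro tendsto_intros up ra a0)
  then have low: "(\<lambda>d. (1 - a d) ^ (r ^ d) - real r ^ d * (real r * a d ^ 2)) \<longlonglongrightarrow>
      exp (- (C * real r powr (- x / 2)))"
    by (simp add: power2_eq_square mult_ac)
  show ?thesis
    unfolding log_K_event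
    by (rule tendsto_sandwich[OF _ _ low up])
      (use prob_all_small_le prob_all_small_ge in \<open>auto simp: a_def\<close>)
qed

section \<open>Almost sure limit\<close>

text \<open>Here the expected number of large clusters at level \<open>d\<close> is
  \<open>O(s ^ d)\<close> with \<open>s = r powr (- e / 2) < 1\<close>, so the failure probabilities
  are summable.\<close>

lemma AE_upper:
  assumes e: "e > 0"
  shows "AE \<omega> in M. \<forall>\<^sub>F d in sequentially.
    log_enat (real r) (K r (\<lambda>v. X v \<omega>) d) \<le> ereal ((2 + e) * real d)"
proof -
  define n where "n d = threshold ((2 + e) * real d)" for d :: nat
  define s where "s = real r powr (- e / 2)"
  have s: "0 < s" "s < 1"
    using r e by (auto simp: s_def powr_less_one)
  have top: "filterlim (\<lambda>d. (2 + e) * real d) at_top sequentially"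
    using e by real_asymp
  have "summable (\<lambda>d. prob (space M - all_small d (n d)))"
  proof (rule summable_comparison_test_ev)
    have "\<forall>\<^sub>F d in sequentially. q (n d) * real r powr ((2 + e) * real d / 2) < C + 1"
      unfolding n_def
      using order_tendstoD(2)[OF filterlim_compose[OF q_threshold top], of "C + 1"] by simp
    then show "\<forall>\<^sub>F d in sequentially. norm (prob (space M - all_small d (n d))) \<le> 2 * real r * (C + 1) * s ^ d"
    proof eventually_elim
      case (elim d)
      let ?q = "q (n d)"
      have "real r powr ((2 + e) * real d / 2) * s ^ d = real r ^ d"
        using r by (simp add: s_def powr_power algebra_simps add_divide_distrib r_powr flip: powr_add)
      then have "real r ^ d * ?q = ?q * real r powr ((2 + e) * real d / 2) * s ^ d"
        by (simp add: mult.assoc)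
      also have "\<dots> \<le> (C + 1) * s ^ d"
        using elim s by (intro mult_right_mono) auto
      finally have q: "real r ^ d * ?q \<le> (C + 1) * s ^ d" .
      \<comment> \<open>Bernoulli's inequality makes the lower bound linear in
        \<open>r ^ d * ?q\<close>; the correction is absorbed by
        \<open>?q\<^sup>2 \<le> ?q\<close>.\<close>
      have "1 - real r ^ d * ?q \<le> (1 - ?q) ^ (r ^ d)"
        using Bernoulli_inequality[of "- ?q" "r ^ d"] q_bounds[of "n d"] by simp
      then have "prob (space M - all_small d (n d)) \<le> real r ^ d * ?q + real r ^ d * (real r * ?q ^ 2)"
        using prob_all_small_ge[of "n d" d] prob_compl[OF all_small_events, of d "n d"] by linarith
      also have "\<dots> \<le> real r * (real r ^ d * ?q) + real r * (real r ^ d * ?q)"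
      proof (rule add_mono)
        have "1 * (real r ^ d * ?q) \<le> real r * (real r ^ d * ?q)"
          using r q_bounds by (intro mult_right_mono) auto
        then show "real r ^ d * ?q \<le> real r * (real r ^ d * ?q)" by simp
        have "real r ^ d * real r * (?q * ?q) \<le> real r ^ d * real r * (?q * 1)"
          using q_bounds by (intro mult_left_mono) auto
        then show "real r ^ d * (real r * ?q ^ 2) \<le> real r * (real r ^ d * ?q)"
          by (simp add: power2_eq_square mult_ac)
      qed
      also have "\<dots> = 2 * real r * (real r ^ d * ?q)" by simp
      also have "\<dots> \<le> 2 * real r * ((C + 1) * s ^ d)"
        by (intro mult_left_mono q) simp
      finally show ?case by (simp add: mult.assoc)
    qed
    show "summable (\<lambda>d. 2 * real r * (C + 1) * s ^ d)"
      using s by (intro summable_mult summable_geometric) simp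
  qed
  then have "AE \<omega> in M. \<forall>\<^sub>F d in sequentially. \<omega> \<in> space M - (space M - all_small d (n d))"
    by (intro borel_cantelli_AE1) (auto simp: emeasure_eq_measure)
  then show ?thesis
  proof eventually_elim
    case (elim \<omega>)
    then show ?case
      by eventually_elim (auto simp: n_def simp flip: log_K_event)
  qed
qed

text \<open>Now the expected number grows at least like \<open>s ^ d\<close> decreases, and
  independence on level \<open>d\<close> alone suffices. The condition \<open>e < 2\<close> lets the
  argument of the threshold tend to infinity, as \<open>q_threshold\<close> requires.\<close>

lemma AE_lower:
  assumes e: "0 < e" "e < 2"
  shows "AE \<omega> in M. \<forall>\<^sub>F d in sequentially.
    ereal ((2 - e) * real d) < log_enat (real r) (K r (\<lambda>v. X v \<omega>) d)"
proof -
  define n where "n d = threshold ((2 - e) * real d)" for d :: nat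
  define s where "s = real r powr (- e / 2)"
  have s: "0 < s" "s < 1"
    using r e by (auto simp: s_def powr_less_one)
  have top: "filterlim (\<lambda>d. (2 - e) * real d) at_top sequentially"
    using e by real_asymp
  have "summable (\<lambda>d. prob (all_small d (n d)))"
  proof (rule summable_comparison_test_ev)
    have "\<forall>\<^sub>F d in sequentially. q (n d) * real r powr ((2 - e) * real d / 2) > C / 2"
      unfolding n_def
      using order_tendstoD(1)[OF filterlim_compose[OF q_threshold top], of "C / 2"] C_pos by simp
    then show "\<forall>\<^sub>F d in sequentially. norm (prob (all_small d (n d))) \<le> 2 / C * s ^ d"
    proof eventually_elim
      case (elim d)
      let ?q = "q (n d)"
      have "real r powr ((2 - e) * real d / 2) = real r ^ d * s ^ d"
        using r by (simp add: s_def powr_power algebra_simps diff_divide_distrib flip: powr_add r_powr)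
      then have q: "C / 2 < real r ^ d * ?q * s ^ d"
        using elim by (simp add: mult_ac)
      then have q0: "real r ^ d * ?q > 0"
        using C_pos s by (intro zero_less_mult_pos2[of "real r ^ d * ?q" "s ^ d"]) auto
      have "prob (all_small d (n d)) \<le> (1 - ?q) ^ (r ^ d)"
        by (rule prob_all_small_le)
      also have "\<dots> \<le> exp (- ?q) ^ (r ^ d)"
        using q_bounds exp_ge_add_one_self[of "- ?q"] by (intro power_mono) auto
      also have "\<dots> = exp (- (real r ^ d * ?q))"
        by (simp flip: exp_of_nat_mult)
      \<comment> \<open>The exponential is weakened to a reciprocal, which still leaves a geometric,
        hence summable, bound.\<close>
      also have "\<dots> \<le> 1 / (real r ^ d * ?q)"
      proof -
        have "real r ^ d * ?q \<le> exp (real r ^ d * ?q)"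
          using exp_ge_add_one_self[of "real r ^ d * ?q"] by linarith
        then show ?thesis
          using q0 by (simp add: exp_minus inverse_eq_divide frac_le)
      qed
      also have "\<dots> \<le> 2 / C * s ^ d"
        using q q0 C_pos by (simp add: field_simps)
      finally show ?case by simp
    qed
    show "summable (\<lambda>d. 2 / C * s ^ d)"
      using s by (intro summable_mult summable_geometric) simp
  qed
  then have "AE \<omega> in M. \<forall>\<^sub>F d in sequentially. \<omega> \<in> space M - all_small d (n d)"
    by (intro borel_cantelli_AE1) (auto simp: emeasure_eq_measure)
  then show ?thesis
  proof eventually_elim
    case (elim \<omega>)
    then show ?case
      by eventually_elim (auto simp: n_def not_le simp flip: log_K_event)
  qed
qed

text \<open>The tolerances \<open>1 / Suc k\<close> are countably many, so their exceptional null
  sets can be united.\<close>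

lemma AE_limit:
  "AE \<omega> in M. (\<lambda>d. log_enat (real r) (K r (\<lambda>v. X v \<omega>) d) / ereal (real d)) \<longlonglongrightarrow> 2"
proof -
  have "AE \<omega> in M. \<forall>k. (\<forall>\<^sub>F d in sequentially.
      log_enat (real r) (K r (\<lambda>v. X v \<omega>) d) \<le> ereal ((2 + 1 / real (Suc k)) * real d)) \<and>
    (\<forall>\<^sub>F d in sequentially.
      ereal ((2 - 1 / real (Suc k)) * real d) < log_enat (real r) (K r (\<lambda>v. X v \<omega>) d))"
  proof (unfold AE_all_countable, rule allI, rule AE_conjI)
    fix k
    have e: "1 / real (Suc k) > 0" "1 / real (Suc k) < 2" by (auto simp: field_simps)
    show "AE \<omega> in M. \<forall>\<^sub>F d in sequentially.
        log_enat (real r) (K r (\<lambda>v. X v \<omega>) d) \<le> ereal ((2 + 1 / real (Suc k)) * real d)"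
      by (rule AE_upper[OF e(1)])
    show "AE \<omega> in M. \<forall>\<^sub>F d in sequentially.
        ereal ((2 - 1 / real (Suc k)) * real d) < log_enat (real r) (K r (\<lambda>v. X v \<omega>) d)"
      by (rule AE_lower[OF e])
  qed
  then show ?thesis
  proof eventually_elim
    case (elim \<omega>)
    define L where "L d = log_enat (real r) (K r (\<lambda>v. X v \<omega>) d)" for d
    \<comment> \<open>The conversion sends infinite values to \<open>0\<close>, but the two eventual
      bounds confine \<open>L d\<close> to finite values, so the limit can be taken among real
      numbers.\<close>
    define l where "l d = real_of_ereal (L d)" for d
    have ev: "\<forall>\<^sub>F d in sequentially. L d = ereal (l d) \<and> d > 0 \<and> \<bar>l d / real d - 2\<bar> \<le> 1 / real (Suc k)" for k
    proof -
      have "\<forall>\<^sub>F d in sequentially. L d \<le> ereal ((2 + 1 / real (Suc k)) * real d)"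
        "\<forall>\<^sub>F d in sequentially. ereal ((2 - 1 / real (Suc k)) * real d) < L d"
        using elim by (auto simp: L_def)
      then show ?thesis
        using eventually_gt_at_top[of 0]
      proof eventually_elim
        case (elim d)
        then obtain t where t: "L d = ereal t" by (cases "L d") auto
        with elim(1,2) have "t \<le> (2 + 1 / real (Suc k)) * real d" "(2 - 1 / real (Suc k)) * real d < t"
          by (simp_all only: ereal_less_eq less_ereal.simps)
        then have "t / real d \<le> 2 + 1 / real (Suc k)" "2 - 1 / real (Suc k) < t / real d"
          using elim(3) by (simp_all only: pos_divide_le_eq pos_less_divide_eq of_nat_0_less_iff)
        then have "\<bar>t / real d - 2\<bar> \<le> 1 / real (Suc k)"
          by linarith
        then show ?case using t elim(3) by (simp add: l_def)
      qed
    qed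
    have "(\<lambda>d. l d / real d) \<longlonglongrightarrow> 2"
    proof (rule tendstoI)
      fix \<epsilon> :: real assume "\<epsilon> > 0"
      then obtain k where k: "1 / real (Suc k) < \<epsilon>"
        using reals_Archimedean[of \<epsilon>] by (auto simp: inverse_eq_divide)
      show "\<forall>\<^sub>F d in sequentially. dist (l d / real d) 2 < \<epsilon>"
        using ev[of k] by eventually_elim (use k in \<open>auto simp: dist_real_def\<close>)
    qed
    then have "(\<lambda>d. ereal (l d / real d)) \<longlonglongrightarrow> ereal 2"
      by simp
    then have "(\<lambda>d. L d / ereal (real d)) \<longlonglongrightarrow> ereal 2"
    proof (rule Lim_transform_eventually)
      show "\<forall>\<^sub>F d in sequentially. ereal (l d / real d) = L d / ereal (real d)"
        using ev[of 0] by eventually_elim simp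
    qed
    then show ?case by (simp add: L_def)
  qed
qed

end

theorem theorem1:
  fixes M :: "'a measure" and X :: "node \<Rightarrow> 'a \<Rightarrow> real" and r :: nat and p :: real
  assumes "prob_space M"
    and "r \<ge> 2"
    and "p = 1 / real r"
    and "prob_space.indep_vars M (\<lambda>_. borel) X (nodes r)"
    and "\<And>v. v \<in> nodes r \<Longrightarrow> measure M {\<omega> \<in> space M. X v \<omega> = 1} = p"
    and "\<And>v. v \<in> nodes r \<Longrightarrow> measure M {\<omega> \<in> space M. X v \<omega> = 0} = 1 - p"
  shows "(AE \<omega> in M. (\<lambda>d. log_enat (real r) (K r (\<lambda>v. X v \<omega>) d) / ereal (real d)) \<longlonglongrightarrow> 2)
    \<and> (\<forall>x::real. (\<lambda>d. measure M {\<omega> \<in> space M.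
            log_enat (real r) (K r (\<lambda>v. X v \<omega>) d) \<le> ereal (2 * real d + x)})
        \<longlonglongrightarrow> exp (- (2 / sqrt (2 * pi * real r * (real r - 1))) * real r powr (- x / 2)))"
proof -
  interpret prob_space M by fact
  interpret critical_percolation M X r
    using assms by unfold_locales auto
  show ?thesis
    using AE_limit law_limit unfolding C_def minus_mult_left by blast
qed

end
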